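(* Assume that $f_1$ satisfies $f_1(0)=f_1(K_1)=0$, $0<f_1(s)\le f_1'(0)s$ for $s\in(0,K_1)$, $f_1'(K_1)<0$, $f_1<0$ in $(-\infty,0)\cup(K_1,+\infty)$; and that, for some $\theta\in(0,K_2)$, $f_2(0)=f_2(\theta)=f_2(K_2)=0$, $f_2'(0)<0$, $f_2'(\theta)>0$, $f_2'(K_2)<0$, $f_2<0$ in $(0,\theta)\cup(K_2,+\infty)$, $f_2>0$ in $(-\infty,0)\cup(\theta,K_2)$. Let $u$ be the solution of (P) with a nonnegative continuous and compactly supported initial datum $u_0\not\equiv0$. Then, for every $\overline{x}\in\mathbb{R}$, $$\inf_{x\le\overline{x}}\Big(\liminf_{t\to+\infty}u(t,x)\Big)>0.$$ Moreover, $u$ propagates to the left with speed $c_1^*=2\sqrt{d_1f_1'(0)}>0$ in the sense that $$\forall\,\varepsilon>0,\quad\lim_{t\to+\infty}\Big(\sup_{x\le-(c_1^*+\varepsilon)t}u(t,x)\Big)=0,$$ $$\forall\,\varepsilon\in(0,c_1^* ),\ \forall\,\delta>0,\ \exists\,x_1\in\mathbb{R},\quad\limsup_{t\to+\infty}\Big(\sup_{-(c_1^*-\varepsilon)t\le x\le x_1}|u(t,x)-K_1|\Big)<\delta.$$ In particular, $\sup_{-ct\le x\le-c't}|u(t,x)-K_1|\to0$ as $t\to+\infty$ for every $0<c'\le c<c_1^*$.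
   Context: Setting. Let $d_1,d_2,\sigma>0$ and let $f_1,f_2\in C^1(\mathbb{R})$, with constants $K_1,K_2>0$. Put $I_1=(-\infty,0)$ (patch 1), $I_2=(0,+\infty)$ (patch 2). Problem (P) is $$\begin{cases}u_t=d_1u_{xx}+f_1(u),& t>0,\ x<0,\\ u_t=d_2u_{xx}+f_2(u),& t>0,\ x>0,\\ u(t,0^-)=u(t,0^+),& t>0,\\ u_x(t,0^-)=\sigma u_x(t,0^+),& t>0,\end{cases}$$ with initial condition $u(0,\cdot)=u_0$. A classical solution is a continuous $u:[0,+\infty)\times\mathbb{R}\to\mathbb{R}$ with $u(0,\cdot)=u_0$, such that for $i=1,2$ the restriction of $u$ to $(0,+\infty)\times\overline{I_i}$ is $C^1$ in $t$ and $C^2$ in $x$ (up to $x=0$), and all identities in (P) hold pointwise. For every nonnegative bounded continuous $u_0$ there is a unique nonnegative bounded classical solution, called the solution of (P) with initial datum $u_0$. *)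

theory Defs
  imports "HOL-Analysis.Analysis"
begin

text \<open>
  The function \<open>u\<close>, restricted to positive times and to \<open>x \<in> X\<close>, is of class C^{1;2}
  in \<open>(t, x)\<close> with partial derivatives \<open>ut\<close>, \<open>ux\<close>, \<open>uxx\<close>, jointly continuous on
  \<open>(0, \<infinity>) \<times> X\<close>. The space derivatives are taken within \<open>X\<close>, hence they are one-sided at
  a boundary point of \<open>X\<close>.
\<close>

definition C12_with ::
  "real set \<Rightarrow> (real \<Rightarrow> real \<Rightarrow> real) \<Rightarrow> (real \<Rightarrow> real \<Rightarrow> real) \<Rightarrow> (real \<Rightarrow> real \<Rightarrow> real)
     \<Rightarrow> (real \<Rightarrow> real \<Rightarrow> real) \<Rightarrow> bool" where
  "C12_with X u ut ux uxx \<longleftrightarrow>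
     (\<forall>t>0. \<forall>x\<in>X.
        ((\<lambda>s. u s x) has_real_derivative ut t x) (at t) \<and>
        (u t has_real_derivative ux t x) (at x within X) \<and>
        (ux t has_real_derivative uxx t x) (at x within X)) \<and>
     continuous_on ({0<..} \<times> X) (\<lambda>(t, x). u t x) \<and>
     continuous_on ({0<..} \<times> X) (\<lambda>(t, x). ut t x) \<and>
     continuous_on ({0<..} \<times> X) (\<lambda>(t, x). ux t x) \<and>
     continuous_on ({0<..} \<times> X) (\<lambda>(t, x). uxx t x)"

text \<open>
  Only the values \<open>u t x\<close> with \<open>t \<ge> 0\<close> are relevant. The indices 1 and 2 refer to the
  restrictions of \<open>u\<close> to the closed patches \<open>x \<le> 0\<close> and \<open>x \<ge> 0\<close>, so that \<open>ux1 t 0\<close> and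
  \<open>ux2 t 0\<close> are the left and right space derivatives of \<open>u t\<close> at the interface.
\<close>

definition classical_solution ::
  "real \<Rightarrow> real \<Rightarrow> real \<Rightarrow> (real \<Rightarrow> real) \<Rightarrow> (real \<Rightarrow> real) \<Rightarrow> (real \<Rightarrow> real)
     \<Rightarrow> (real \<Rightarrow> real \<Rightarrow> real) \<Rightarrow> bool" where
  "classical_solution d1 d2 \<sigma> f1 f2 u0 u \<longleftrightarrow>
     continuous_on ({0..} \<times> UNIV) (\<lambda>(t, x). u t x) \<and>
     (\<forall>x. u 0 x = u0 x) \<and>
     (\<exists>ut1 ux1 uxx1 ut2 ux2 uxx2.
        C12_with {..0} u ut1 ux1 uxx1 \<and>
        C12_with {0..} u ut2 ux2 uxx2 \<and>
        (\<forall>t>0. \<forall>x<0. ut1 t x = d1 * uxx1 t x + f1 (u t x)) \<and>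
        (\<forall>t>0. \<forall>x>0. ut2 t x = d2 * uxx2 t x + f2 (u t x)) \<and>
        (\<forall>t>0. \<exists>l. (u t \<longlongrightarrow> l) (at_left 0) \<and> (u t \<longlongrightarrow> l) (at_right 0)) \<and>
        (\<forall>t>0. ux1 t 0 = \<sigma> * ux2 t 0))"

text \<open>
  The nonnegative bounded classical solution with initial datum \<open>u0\<close>; boundedness is global
  in time and space.
\<close>

definition solution_P ::
  "real \<Rightarrow> real \<Rightarrow> real \<Rightarrow> (real \<Rightarrow> real) \<Rightarrow> (real \<Rightarrow> real) \<Rightarrow> (real \<Rightarrow> real)
     \<Rightarrow> (real \<Rightarrow> real \<Rightarrow> real) \<Rightarrow> bool" where
  "solution_P d1 d2 \<sigma> f1 f2 u0 u \<longleftrightarrow>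
     classical_solution d1 d2 \<sigma> f1 f2 u0 u \<and>
     (\<forall>t\<ge>0. \<forall>x. 0 \<le> u t x) \<and>
     bounded ((\<lambda>(t, x). u t x) ` ({0..} \<times> UNIV))"

definition KPP :: "real \<Rightarrow> (real \<Rightarrow> real) \<Rightarrow> bool" where
  "KPP K f \<longleftrightarrow>
     f 0 = 0 \<and> f K = 0 \<and>
     (\<forall>s\<in>{0<..<K}. 0 < f s \<and> f s \<le> deriv f 0 * s) \<and>
     deriv f K < 0 \<and>
     (\<forall>s\<in>{..<0} \<union> {K<..}. f s < 0)"

definition bistable :: "real \<Rightarrow> real \<Rightarrow> (real \<Rightarrow> real) \<Rightarrow> bool" where
  "bistable \<theta> K f \<longleftrightarrow>
     \<theta> \<in> {0<..<K} \<and>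
     f 0 = 0 \<and> f \<theta> = 0 \<and> f K = 0 \<and>
     deriv f 0 < 0 \<and> deriv f \<theta> > 0 \<and> deriv f K < 0 \<and>
     (\<forall>s\<in>{0<..<\<theta>} \<union> {K<..}. f s < 0) \<and>
     (\<forall>s\<in>{..<0} \<union> {\<theta><..<K}. f s > 0)"

definition KPP_speed :: "real \<Rightarrow> (real \<Rightarrow> real) \<Rightarrow> real" where
  "KPP_speed d f = 2 * sqrt (d * deriv f 0)"

end

theory Submission
  imports Defs
begin

text \<open>
  The problem is scalar and its two patches are coupled only by one flux condition, so the
  maximum principle holds across the interface: if \<open>v\<close> is a subsolution whose derivatives at
  the interface satisfy \<open>v\<^sub>x(t, 0-) < \<sigma> v\<^sub>x(t, 0+)\<close>, then \<open>v - u\<close> cannot have its first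
  positive maximum at \<open>x = 0\<close>, because there the left derivative of \<open>v - u\<close> would be
  nonnegative and the right one nonpositive. Everything asserted about \<open>u\<close> follows by
  comparing it with explicit functions; no other solution of the problem has to be constructed.

  Upper bounds live in the KPP patch alone, where the interface is treated as a boundary at which
  only \<open>u \<le> M\<close> is known. Since \<open>f1 s \<le> f1'(0) s\<close>, the linear front
  \<open>exp (\<lambda> (x + c1 t))\<close> with \<open>\<lambda> = sqrt (f1'(0) / d1)\<close> dominates \<open>u\<close> and gives the decay ahead
  of the speed \<open>c1\<close> (\<open>KPP_speed_upper_bound\<close>). Since \<open>f1\<close> pulls values above \<open>K1\<close> down at a
  linear rate, \<open>u\<close> exceeds \<open>K1\<close> by at most an error that decays exponentially in time and in
  the distance to the interface (\<open>KPP_capacity_upper_bound\<close>).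

  The lower bounds form a chain. A bump whose support grows at any prescribed speed, and which
  crosses the interface if the space variable is rescaled differently in the two patches, shows
  that \<open>u > 0\<close> at every positive time (\<open>strictly_positive\<close>). This leaves room for a small
  multiple of the function \<open>exp (\<beta> y) cos (\<omega> y)\<close>, \<open>\<bar>y\<bar> \<le> R\<close>, travelling to the left
  with a speed \<open>c' < c1\<close>; it is a subsolution if \<open>R\<close> is large. Every point behind a front of
  speed \<open>c < c1\<close> is the centre of such a bump for one \<open>c' \<in> [0, c]\<close>, which gives one positive
  lower bound on the whole region \<open>-R - c (t - 1) \<le> x \<le> -R\<close> (\<open>KPP_persistence\<close>). Between
  a positive floor and \<open>K1\<close> the reaction is at least \<open>\<kappa> (K1 - u)\<close>, so \<open>K1 - u\<close> is
  controlled by three exponentials, one for the initial time and one for each end of the region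
  (\<open>convergence_lower_bound\<close>); this yields convergence to \<open>K1\<close> away from both ends. Finally the
  floor at \<open>x = -R\<close> is carried into the second patch, over any bounded distance, by a
  stationary subsolution (\<open>interface_crossing_lower_bound\<close>).
\<close>

section \<open>A parabolic maximum principle with an interface\<close>

lemma left_derivative_nonneg_at_max:
  fixes f :: "real \<Rightarrow> real"
  assumes "(f has_real_derivative D) (at a within {..a})"
    and "\<forall>\<^sub>F y in at_left a. f y \<le> f a"
  shows "0 \<le> D"
proof -
  have "(f has_real_derivative D) (at_left a)"
    using assms(1) by (rule DERIV_subset) auto
  then have lim: "((\<lambda>y. (f y - f a) / (y - a)) \<longlongrightarrow> D) (at_left a)"
    by (simp add: has_field_derivative_iff)
  have "\<forall>\<^sub>F y in at_left a. 0 \<le> (f y - f a) / (y - a)"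
    using assms(2) by (auto simp: eventually_at_filter elim!: eventually_mono intro!: divide_nonpos_nonpos)
  then show ?thesis
    using lim by (intro tendsto_lowerbound) auto
qed

lemma right_derivative_nonpos_at_max:
  fixes f :: "real \<Rightarrow> real"
  assumes "(f has_real_derivative D) (at a within {a..})"
    and "\<forall>\<^sub>F y in at_right a. f y \<le> f a"
  shows "D \<le> 0"
proof -
  have "(f has_real_derivative D) (at_right a)"
    using assms(1) by (rule DERIV_subset) auto
  then have lim: "((\<lambda>y. (f y - f a) / (y - a)) \<longlongrightarrow> D) (at_right a)"
    by (simp add: has_field_derivative_iff)
  have "\<forall>\<^sub>F y in at_right a. (f y - f a) / (y - a) \<le> 0"
    using assms(2) by (auto simp: eventually_at_filter elim!: eventually_mono intro!: divide_nonpos_nonneg)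
  then show ?thesis
    using lim by (intro tendsto_upperbound) auto
qed

lemma second_derivative_nonpos_at_max:
  fixes f f' :: "real \<Rightarrow> real"
  assumes f: "\<forall>\<^sub>F y in nhds a. (f has_real_derivative f' y) (at y)"
    and f': "(f' has_real_derivative s) (at a)"
    and max: "\<forall>\<^sub>F y in nhds a. f y \<le> f a"
  shows "s \<le> 0"
proof (rule ccontr)
  assume "\<not> s \<le> 0"
  then have "s > 0" by simp
  from f max obtain e where e: "e > 0"
    "\<And>y. \<bar>y - a\<bar> < e \<Longrightarrow> (f has_real_derivative f' y) (at y)"
    "\<And>y. \<bar>y - a\<bar> < e \<Longrightarrow> f y \<le> f a"
    using eventually_conj[OF f max] unfolding eventually_nhds_metric dist_real_def by blast
  have "f' a = 0"
    using DERIV_local_max[OF e(2)[of a] e(1)] e by (simp add: abs_minus_commute)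
  obtain h where h: "h > 0" "\<And>y. 0 < y \<Longrightarrow> y < h \<Longrightarrow> f' a < f' (a + y)"
    using DERIV_pos_inc_right[OF f' \<open>s > 0\<close>] by auto
  define y where "y = min e h / 2"
  have y: "0 < y" "y < e" "y < h" using e h by (auto simp: y_def)
  have "\<exists>c. a < c \<and> c < a + y \<and> f (a + y) - f a = (a + y - a) * f' c"
    by (rule MVT2) (use y e in auto)
  then obtain c where c: "a < c" "c < a + y" "f (a + y) - f a = y * f' c"
    by auto
  have "f' c > 0"
    using h(2)[of "c - a"] c y \<open>f' a = 0\<close> by auto
  then have "f (a + y) > f a"
    using c(3) y(1) by (metis mult_pos_pos diff_gt_0_iff_gt)
  then show False using e(3)[of "a + y"] y by auto
qed

text \<open>
  At a positive maximum of \<open>exp (- \<mu> t) z t x\<close> over the part \<open>q \<ge> 0\<close> of the rectangle,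
  \<open>z\<close> satisfies \<open>zt \<ge> \<mu> z\<close> and \<open>zxx \<le> 0\<close> if the point lies off the interface, and \<open>l \<ge> 0 \<ge> r\<close>
  if it lies on it. The time derivative is only tested from the left, so the final time is
  allowed.

  All conditions are imposed only where \<open>z\<close> is positive. For a lower barrier \<open>z = v - u\<close> this
  means that the differential inequality matters only at values \<open>u < v\<close>, where the reaction
  term can be estimated. The function \<open>q\<close> describes domains whose ends move in time: a barrier
  need not be truncated outside its support, because the comparison never leaves \<open>q \<ge> 0\<close>.
\<close>

lemma parabolic_maximum_principle:
  fixes z q :: "real \<Rightarrow> real \<Rightarrow> real" and \<mu> \<sigma> :: real
  assumes z: "continuous_on ({t0..T} \<times> {A..B}) (\<lambda>(t, x). z t x)"
    and q: "continuous_on UNIV (\<lambda>(t, x). q t x)"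
    and \<sigma>: "\<sigma> \<ge> 0"
    and bdry: "\<And>t x. t0 \<le> t \<Longrightarrow> t \<le> T \<Longrightarrow> A \<le> x \<Longrightarrow> x \<le> B \<Longrightarrow> 0 \<le> q t x \<Longrightarrow> 0 < z t x \<Longrightarrow>
        t \<noteq> t0 \<and> x \<noteq> A \<and> x \<noteq> B \<and> q t x \<noteq> 0"
    and int: "\<And>t x. t0 < t \<Longrightarrow> t \<le> T \<Longrightarrow> A < x \<Longrightarrow> x < B \<Longrightarrow> x \<noteq> 0 \<Longrightarrow> 0 < q t x \<Longrightarrow> 0 < z t x \<Longrightarrow>
        \<exists>D zt zx zxx. D \<ge> 0 \<and> ((\<lambda>s. z s x) has_real_derivative zt) (at t) \<and>
          (\<forall>\<^sub>F y in nhds x. (z t has_real_derivative zx y) (at y)) \<and>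
          (zx has_real_derivative zxx) (at x) \<and> zt - D * zxx < \<mu> * z t x"
    and interface: "\<And>t. t0 < t \<Longrightarrow> t \<le> T \<Longrightarrow> A < 0 \<Longrightarrow> 0 < B \<Longrightarrow> 0 < q t 0 \<Longrightarrow> 0 < z t 0 \<Longrightarrow>
        \<exists>l r. (z t has_real_derivative l) (at 0 within {..0}) \<and>
          (z t has_real_derivative r) (at 0 within {0..}) \<and> l < \<sigma> * r"
    and tx: "t0 \<le> t" "t \<le> T" "A \<le> x" "x \<le> B" "0 \<le> q t x"
  shows "z t x \<le> 0"
proof (rule ccontr)
  assume "\<not> z t x \<le> 0"
  then have zpos: "z t x > 0" by simp
  define K where "K = ({t0..T} \<times> {A..B}) \<inter> {p. 0 \<le> (\<lambda>(t, x). q t x) p}"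
  have "closed {p. 0 \<le> (\<lambda>(t, x). q t x) p}"
    by (rule closed_Collect_le) (use q in \<open>auto simp: continuous_on_const\<close>)
  then have "compact K"
    unfolding K_def by (intro compact_Int_closed compact_Times compact_Icc)
  moreover have "(t, x) \<in> K" using tx by (auto simp: K_def)
  moreover have "continuous_on K (\<lambda>p. exp (- \<mu> * fst p) * (\<lambda>(t, x). z t x) p)"
    by (intro continuous_intros continuous_on_subset[OF z]) (auto simp: K_def)
  ultimately have "\<exists>p\<in>K. \<forall>p'\<in>K. exp (- \<mu> * fst p') * (\<lambda>(t, x). z t x) p'
      \<le> exp (- \<mu> * fst p) * (\<lambda>(t, x). z t x) p"
    by (intro continuous_attains_sup) auto
  then obtain p where "p \<in> K" and
      p: "\<And>p'. p' \<in> K \<Longrightarrow> exp (- \<mu> * fst p') * (\<lambda>(t, x). z t x) p' \<le> exp (- \<mu> * fst p) * (\<lambda>(t, x). z t x) p"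
    by blast
  obtain s y where sy: "p = (s, y)" by force
  have max: "exp (- \<mu> * s') * z s' y' \<le> exp (- \<mu> * s) * z s y" if "(s', y') \<in> K" for s' y'
    using p[OF that] sy by simp
  have "0 < exp (- \<mu> * s) * z s y"
    using max[OF \<open>(t, x) \<in> K\<close>] zpos by (meson exp_gt_zero less_le_trans mult_pos_pos)
  then have pos: "z s y > 0" by (simp add: zero_less_mult_iff)
  have "(s, y) \<in> K" using \<open>p \<in> K\<close> sy by simp
  then have "t0 \<le> s" "s \<le> T" "A \<le> y" "y \<le> B" "0 \<le> q s y" by (auto simp: K_def)
  with bdry[OF this pos] have in_K: "t0 < s" "s \<le> T" "A < y" "y < B" "0 < q s y" by auto
  have "continuous_on UNIV (\<lambda>r. q r y)" "continuous_on UNIV (\<lambda>r. q s r)"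
    using continuous_on_compose2[OF q continuous_on_Pair[OF continuous_on_id continuous_on_const]]
      continuous_on_compose2[OF q continuous_on_Pair[OF continuous_on_const continuous_on_id]]
    by auto
  then have "isCont (\<lambda>r. q r y) s" and q_x': "isCont (\<lambda>r. q s r) y"
    by (simp_all add: continuous_on_eq_continuous_at)
  then have q_t: "((\<lambda>r. q r y) \<longlongrightarrow> q s y) (at_left s)"
    by (simp add: isCont_def filterlim_at_split)
  have q_x: "((\<lambda>r. q s r) \<longlongrightarrow> q s y) (nhds y)"
    using q_x' by (simp add: isCont_def tendsto_nhds_iff)
  have max_t: "\<forall>\<^sub>F r in at_left s. exp (- \<mu> * r) * z r y \<le> exp (- \<mu> * s) * z s y"
    using order_tendstoD(1)[OF q_t \<open>0 < q s y\<close>] eventually_at_left_real[OF \<open>t0 < s\<close>]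
    by eventually_elim (rule max, use in_K in \<open>auto simp: K_def\<close>)
  have in_AB: "\<forall>\<^sub>F r in nhds y. r \<in> {A<..<B}"
    by (rule eventually_nhds_in_open) (use in_K in auto)
  have max_x: "\<forall>\<^sub>F r in nhds y. z s r \<le> z s y"
    using order_tendstoD(1)[OF q_x \<open>0 < q s y\<close>] in_AB
  proof eventually_elim
    case (elim r)
    then have "(s, r) \<in> K" using in_K by (auto simp: K_def)
    from max[OF this] show ?case by simp
  qed
  show False
  proof (cases "y = 0")
    case True
    obtain l r where lr: "(z s has_real_derivative l) (at 0 within {..0})"
      "(z s has_real_derivative r) (at 0 within {0..})" "l < \<sigma> * r"
      using interface[of s] in_K pos True by auto
    have "\<forall>\<^sub>F r in at 0 within S. z s r \<le> z s 0" for S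
      using max_x True by (auto simp: eventually_at_filter elim: eventually_mono)
    then have "0 \<le> l" "r \<le> 0"
      using left_derivative_nonneg_at_max[OF lr(1)] right_derivative_nonpos_at_max[OF lr(2)] by blast+
    then show False using lr(3) \<sigma> mult_nonneg_nonpos[of \<sigma> r] by linarith
  next
    case False
    obtain D zt zx zxx where D: "D \<ge> 0" "((\<lambda>r. z r y) has_real_derivative zt) (at s)"
      "\<forall>\<^sub>F r in nhds y. (z s has_real_derivative zx r) (at r)"
      "(zx has_real_derivative zxx) (at y)" "zt - D * zxx < \<mu> * z s y"
      using int[OF in_K(1-4) False in_K(5) pos] by auto
    have "((\<lambda>r. exp (- \<mu> * r) * z r y) has_real_derivative
        exp (- \<mu> * s) * (zt - \<mu> * z s y)) (at s)"
      by (auto intro!: derivative_eq_intros D(2) simp: algebra_simps)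
    then have "0 \<le> exp (- \<mu> * s) * (zt - \<mu> * z s y)"
      by (intro left_derivative_nonneg_at_max[OF _ max_t]) (rule has_field_derivative_at_within)
    then have "0 \<le> zt - \<mu> * z s y" by (simp add: zero_le_mult_iff)
    moreover have "D * zxx \<le> 0"
      using second_derivative_nonpos_at_max[OF D(3,4) max_x] D(1) by (simp add: mult_nonneg_nonpos)
    ultimately show False using D(5) by linarith
  qed
qed

section \<open>Elementary estimates for reaction terms and exponentials\<close>

text \<open>
  The difference quotient of \<open>f\<close> at \<open>a\<close>, completed by its limit. Being continuous, it turns
  local information on the derivative at a zero of \<open>f\<close> into linear bounds on compact intervals.
\<close>

definition slope :: "(real \<Rightarrow> real) \<Rightarrow> real \<Rightarrow> real \<Rightarrow> real" where
  "slope f a s = (if s = a then deriv f a else (f s - f a) / (s - a))"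

lemma slope_mult: "f s - f a = slope f a s * (s - a)"
  by (simp add: slope_def)

lemma C1_has_deriv:
  assumes "f C1_differentiable_on UNIV"
  shows "(f has_real_derivative deriv f x) (at x)"
proof -
  obtain D where "(f has_vector_derivative D x) (at x)"
    using assms unfolding C1_differentiable_on_def by blast
  then have "(f has_real_derivative D x) (at x)"
    by (simp add: has_real_derivative_iff_has_vector_derivative)
  then show ?thesis by (metis DERIV_imp_deriv)
qed

lemma continuous_on_slope:
  assumes f: "\<And>x. (f has_real_derivative deriv f x) (at x)"
  shows "continuous_on S (slope f a)"
proof -
  have "isCont (slope f a) s" for s
  proof (cases "s = a")
    case True
    have "((\<lambda>y. (f y - f a) / (y - a)) \<longlongrightarrow> deriv f a) (at a)"
      using f[of a] by (simp add: has_field_derivative_iff)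
    then have "(slope f a \<longlongrightarrow> deriv f a) (at a)"
      by (rule Lim_transform_eventually) (auto simp: eventually_at_filter slope_def)
    then show ?thesis using True by (simp add: isCont_def slope_def)
  next
    case False
    have "isCont (\<lambda>y. (f y - f a) / (y - a)) s"
      using f False by (intro continuous_intros DERIV_isCont[OF f]) auto
    moreover have "\<forall>\<^sub>F y in nhds s. y \<in> - {a}"
      using False by (intro eventually_nhds_in_open) auto
    then have "\<forall>\<^sub>F y in nhds s. slope f a y = (f y - f a) / (y - a)"
      by eventually_elim (simp add: slope_def)
    then have "isCont (slope f a) s \<longleftrightarrow> isCont (\<lambda>y. (f y - f a) / (y - a)) s"
      by (rule isCont_cong)
    ultimately show ?thesis by simp
  qed
  then show ?thesis by (simp add: continuous_at_imp_continuous_on)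
qed

lemma linear_lower_bound:
  assumes f: "\<And>x. (f has_real_derivative deriv f x) (at x)" and "f 0 = 0" "M > 0"
  obtains m where "m > 0" "\<And>s. 0 \<le> s \<Longrightarrow> s \<le> M \<Longrightarrow> - m * s \<le> f s"
proof -
  have "\<exists>y\<in>{0..M}. \<forall>s\<in>{0..M}. slope f 0 y \<le> slope f 0 s"
    using \<open>M > 0\<close> by (intro continuous_attains_inf continuous_on_slope f) auto
  then obtain y where y: "\<forall>s\<in>{0..M}. slope f 0 y \<le> slope f 0 s"
    by blast
  show ?thesis
  proof (rule that[of "1 + \<bar>slope f 0 y\<bar>"])
    fix s assume s: "0 \<le> s" "s \<le> M"
    have "- (1 + \<bar>slope f 0 y\<bar>) \<le> slope f 0 s" using y s by force
    from mult_right_mono[OF this s(1)] show "- (1 + \<bar>slope f 0 y\<bar>) * s \<le> f s"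
      using slope_mult[of f s 0] \<open>f 0 = 0\<close> by simp
  qed simp
qed

lemma tangent_lower_bound:
  assumes f: "\<And>x. (f has_real_derivative deriv f x) (at x)" and "f 0 = 0" "g < deriv f 0"
  obtains s0 where "s0 > 0" "\<And>s. 0 \<le> s \<Longrightarrow> s \<le> s0 \<Longrightarrow> g * s \<le> f s"
proof -
  have "isCont (slope f 0) 0"
    using continuous_on_slope[OF f, of UNIV] by (simp add: continuous_on_eq_continuous_at)
  then have "(slope f 0 \<longlongrightarrow> deriv f 0) (nhds 0)"
    by (simp add: isCont_def tendsto_nhds_iff slope_def)
  from order_tendstoD(1)[OF this \<open>g < deriv f 0\<close>]
  obtain e where e: "e > 0" "\<And>s. \<bar>s\<bar> < e \<Longrightarrow> g < slope f 0 s"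
    by (auto simp: eventually_nhds_metric dist_real_def)
  show ?thesis
  proof (rule that[of "e / 2"])
    fix s assume s: "0 \<le> s" "s \<le> e / 2"
    then have "g \<le> slope f 0 s" using e by (auto intro: less_imp_le)
    from mult_right_mono[OF this s(1)] show "g * s \<le> f s"
      using slope_mult[of f s 0] \<open>f 0 = 0\<close> by simp
  qed (use e in simp)
qed

text \<open>
  The sign conditions make the completed difference quotient at the capacity negative on
  \<open>(0, \<infinity>)\<close>, at \<open>K\<close> itself by \<open>f'(K) < 0\<close>. Its maximum over a compact interval is \<open>- \<kappa>\<close>, so one
  rate controls the return to \<open>K\<close> from both sides.
\<close>

lemma KPP_restoring:
  assumes f: "\<And>x. (f has_real_derivative deriv f x) (at x)" and "KPP K f" "0 < a" "a \<le> b"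
  obtains \<kappa> where "\<kappa> > 0" "\<And>s. a \<le> s \<Longrightarrow> s \<le> K \<Longrightarrow> s \<le> b \<Longrightarrow> \<kappa> * (K - s) \<le> f s"
    "\<And>s. a \<le> s \<Longrightarrow> K \<le> s \<Longrightarrow> s \<le> b \<Longrightarrow> f s \<le> - \<kappa> * (s - K)"
proof -
  have "\<exists>y\<in>{a..b}. \<forall>s\<in>{a..b}. slope f K s \<le> slope f K y"
    using assms by (intro continuous_attains_sup continuous_on_slope f) auto
  then obtain y where y: "y \<in> {a..b}" "\<forall>s\<in>{a..b}. slope f K s \<le> slope f K y"
    by blast
  have "f K = 0" using assms by (simp add: KPP_def)
  have "0 < y" using y(1) assms by simp
  have "slope f K y < 0"
  proof (cases y K rule: linorder_cases)
    case less
    then show ?thesis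
      using \<open>KPP K f\<close> \<open>0 < y\<close> \<open>f K = 0\<close> by (simp add: slope_def KPP_def divide_pos_neg)
  next
    case greater
    then show ?thesis
      using \<open>KPP K f\<close> \<open>f K = 0\<close> by (simp add: slope_def KPP_def divide_neg_pos)
  qed (use \<open>KPP K f\<close> in \<open>simp add: slope_def KPP_def\<close>)
  show ?thesis
  proof (rule that[of "- slope f K y"])
    fix s assume s: "a \<le> s" "s \<le> K" "s \<le> b"
    have "- slope f K y * (K - s) \<le> - slope f K s * (K - s)"
      using bspec[OF y(2), of s] s by (intro mult_right_mono) simp_all
    also have "\<dots> = f s" using slope_mult[of f s K] \<open>f K = 0\<close> by (simp add: algebra_simps)
    finally show "- slope f K y * (K - s) \<le> f s" .
  next
    fix s assume s: "a \<le> s" "K \<le> s" "s \<le> b"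
    have "slope f K s * (s - K) \<le> slope f K y * (s - K)"
      using bspec[OF y(2), of s] s by (intro mult_right_mono) simp_all
    then show "f s \<le> - (- slope f K y) * (s - K)"
      using slope_mult[of f s K] \<open>f K = 0\<close> by simp
  qed (use \<open>slope f K y < 0\<close> in simp)
qed

lemma KPP_rate_pos:
  assumes "KPP K f" "K > 0"
  shows "deriv f 0 > 0"
proof -
  have "K / 2 \<in> {0<..<K}" using assms by simp
  then have "0 < f (K / 2)" "f (K / 2) \<le> deriv f 0 * (K / 2)"
    using assms(1) unfolding KPP_def by blast+
  then have "0 < deriv f 0 * (K / 2)" by linarith
  then show ?thesis using assms by (simp add: zero_less_mult_iff)
qed

lemma exp_decay:
  fixes a b C :: real
  assumes "a > 0"
  shows "((\<lambda>t. C * exp (b - a * t)) \<longlongrightarrow> 0) at_top"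
proof -
  have "((\<lambda>t. C * exp b * exp (- (a * t))) \<longlongrightarrow> C * exp b * 0) at_top"
    using assms
    by (intro tendsto_intros filterlim_compose[OF exp_at_bot] filterlim_compose[OF filterlim_uminus_at_bot_at_top]
        filterlim_tendsto_pos_mult_at_top[OF tendsto_const] filterlim_ident)
  then show ?thesis by (simp add: mult.assoc mult_exp_exp)
qed

lemma exp_decay_eventually_small:
  fixes a b e C :: real
  assumes "a > 0" "e > 0"
  shows "\<forall>\<^sub>F t in at_top. C * exp (b - a * t) \<le> e"
  using order_tendstoD(2)[OF exp_decay[OF assms(1), where C = C and b = b] assms(2)] by (auto elim: eventually_mono)

lemma linear_eventually_nonneg:
  fixes a b :: real
  assumes "a > 0"
  shows "\<forall>\<^sub>F t in at_top. 0 \<le> a * t + b"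
  using eventually_ge_at_top[of "- b / a"] by eventually_elim (use assms in \<open>simp add: field_simps\<close>)

section \<open>Comparison with barriers\<close>

text \<open>
  A bounded nonnegative solution together with an upper bound \<open>M\<close> and with witnesses for its
  partial derivatives on each closed patch, so that barriers can be compared with named functions.
\<close>

locale two_patch_solution =
  fixes d1 d2 \<sigma> :: real and f1 f2 u0 :: "real \<Rightarrow> real" and u :: "real \<Rightarrow> real \<Rightarrow> real" and M :: real
    and ut1 ux1 uxx1 ut2 ux2 uxx2 :: "real \<Rightarrow> real \<Rightarrow> real"
  assumes d1: "d1 > 0" and d2: "d2 > 0" and \<sigma>: "\<sigma> > 0" and M: "M > 0"
    and u_cont: "continuous_on ({0..} \<times> UNIV) (\<lambda>(t, x). u t x)"
    and u_init: "u 0 x = u0 x"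
    and C12_left: "C12_with {..0} u ut1 ux1 uxx1"
    and C12_right: "C12_with {0..} u ut2 ux2 uxx2"
    and pde_left: "t > 0 \<Longrightarrow> x < 0 \<Longrightarrow> ut1 t x = d1 * uxx1 t x + f1 (u t x)"
    and pde_right: "t > 0 \<Longrightarrow> x > 0 \<Longrightarrow> ut2 t x = d2 * uxx2 t x + f2 (u t x)"
    and flux: "t > 0 \<Longrightarrow> ux1 t 0 = \<sigma> * ux2 t 0"
    and u_nonneg: "t \<ge> 0 \<Longrightarrow> 0 \<le> u t x"
    and u_le_M: "t \<ge> 0 \<Longrightarrow> u t x \<le> M"
begin

lemma left_derivatives:
  assumes "t > 0" "x < 0"
  shows "((\<lambda>s. u s x) has_real_derivative d1 * uxx1 t x + f1 (u t x)) (at t)"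
    and "\<forall>\<^sub>F y in nhds x. (u t has_real_derivative ux1 t y) (at y)"
    and "(ux1 t has_real_derivative uxx1 t x) (at x)"
proof -
  have D: "((\<lambda>s. u s y) has_real_derivative ut1 t y) (at t)"
    "(u t has_real_derivative ux1 t y) (at y within {..0})"
    "(ux1 t has_real_derivative uxx1 t y) (at y within {..0})" if "y < 0" for y
    using C12_left that \<open>t > 0\<close> unfolding C12_with_def by auto
  have at: "at y within {..0} = at y" if "y < 0" for y :: real
    using that by (intro at_within_interior) simp
  show "((\<lambda>s. u s x) has_real_derivative d1 * uxx1 t x + f1 (u t x)) (at t)"
    using D(1)[OF \<open>x < 0\<close>] pde_left[OF assms] by simp
  show "(ux1 t has_real_derivative uxx1 t x) (at x)"
    using D(3)[OF \<open>x < 0\<close>] at[OF \<open>x < 0\<close>] by simp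
  have "\<forall>\<^sub>F y in nhds x. y \<in> {..<0}"
    using \<open>x < 0\<close> by (intro eventually_nhds_in_open) auto
  then show "\<forall>\<^sub>F y in nhds x. (u t has_real_derivative ux1 t y) (at y)"
    by eventually_elim (use D(2) at in auto)
qed

lemma right_derivatives:
  assumes "t > 0" "x > 0"
  shows "((\<lambda>s. u s x) has_real_derivative d2 * uxx2 t x + f2 (u t x)) (at t)"
    and "\<forall>\<^sub>F y in nhds x. (u t has_real_derivative ux2 t y) (at y)"
    and "(ux2 t has_real_derivative uxx2 t x) (at x)"
proof -
  have D: "((\<lambda>s. u s y) has_real_derivative ut2 t y) (at t)"
    "(u t has_real_derivative ux2 t y) (at y within {0..})"
    "(ux2 t has_real_derivative uxx2 t y) (at y within {0..})" if "y > 0" for y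
    using C12_right that \<open>t > 0\<close> unfolding C12_with_def by auto
  have at: "at y within {0..} = at y" if "y > 0" for y :: real
    using that by (intro at_within_interior) simp
  show "((\<lambda>s. u s x) has_real_derivative d2 * uxx2 t x + f2 (u t x)) (at t)"
    using D(1)[OF \<open>x > 0\<close>] pde_right[OF assms] by simp
  show "(ux2 t has_real_derivative uxx2 t x) (at x)"
    using D(3)[OF \<open>x > 0\<close>] at[OF \<open>x > 0\<close>] by simp
  have "\<forall>\<^sub>F y in nhds x. y \<in> {0<..}"
    using \<open>x > 0\<close> by (intro eventually_nhds_in_open) auto
  then show "\<forall>\<^sub>F y in nhds x. (u t has_real_derivative ux2 t y) (at y)"
    by eventually_elim (use D(2) at in auto)
qed

lemma interface_derivatives:
  assumes "t > 0"
  shows "(u t has_real_derivative ux1 t 0) (at 0 within {..0})"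
    and "(u t has_real_derivative ux2 t 0) (at 0 within {0..})"
  using C12_left C12_right assms unfolding C12_with_def by auto

lemma u_cont_on: "S \<subseteq> {0..} \<times> UNIV \<Longrightarrow> continuous_on S (\<lambda>(t, x). u t x)"
  using u_cont continuous_on_subset by blast

lemma u_cont_space: "t \<ge> 0 \<Longrightarrow> continuous_on S (u t)"
  using continuous_on_compose2[OF u_cont continuous_on_Pair[OF continuous_on_const continuous_on_id]]
  by (auto simp: image_subset_iff)

text \<open>
  The barrier is given by one smooth formula on each patch, and only continuity is required
  where the formulas meet. The interface condition is strict because \<open>u\<close> itself satisfies it with
  equality. The differential inequalities are stated with the reaction at the value of the
  solution: each barrier below satisfies a linear differential inequality, and the nonlinearity is estimated
  by a linear function at \<open>u t x\<close>.
\<close>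

lemma lower_barrier:
  fixes vl vr q :: "real \<Rightarrow> real \<Rightarrow> real" and \<mu> :: real
  defines "v \<equiv> \<lambda>t x. if x \<le> 0 then vl t x else vr t x"
  assumes \<tau>: "\<tau> \<ge> 0"
    and cont: "continuous_on UNIV (\<lambda>(t, x). vl t x)" "continuous_on UNIV (\<lambda>(t, x). vr t x)"
      "continuous_on UNIV (\<lambda>(t, x). q t x)"
    and vl: "\<And>t x. x < 0 \<Longrightarrow> ((\<lambda>s. vl s x) has_real_derivative vlt t x) (at t)"
      "\<And>t x. x \<le> 0 \<Longrightarrow> (vl t has_real_derivative vlx t x) (at x)"
      "\<And>t x. x < 0 \<Longrightarrow> (vlx t has_real_derivative vlxx t x) (at x)"
    and vr: "\<And>t x. x > 0 \<Longrightarrow> ((\<lambda>s. vr s x) has_real_derivative vrt t x) (at t)"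
      "\<And>t x. x \<ge> 0 \<Longrightarrow> (vr t has_real_derivative vrx t x) (at x)"
      "\<And>t x. x > 0 \<Longrightarrow> (vrx t has_real_derivative vrxx t x) (at x)"
    and glue: "\<And>t. vl t 0 = vr t 0"
    and bdry: "\<And>t x. \<tau> \<le> t \<Longrightarrow> t \<le> T \<Longrightarrow> A \<le> x \<Longrightarrow> x \<le> B \<Longrightarrow> 0 \<le> q t x \<Longrightarrow>
        t = \<tau> \<or> x = A \<or> x = B \<or> q t x = 0 \<Longrightarrow> v t x \<le> u t x"
    and left: "\<And>t x. \<tau> < t \<Longrightarrow> t \<le> T \<Longrightarrow> A < x \<Longrightarrow> x < B \<Longrightarrow> x < 0 \<Longrightarrow> 0 < q t x \<Longrightarrow> u t x < vl t x \<Longrightarrow>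
        vlt t x - d1 * vlxx t x < f1 (u t x) + \<mu> * (vl t x - u t x)"
    and right: "\<And>t x. \<tau> < t \<Longrightarrow> t \<le> T \<Longrightarrow> A < x \<Longrightarrow> x < B \<Longrightarrow> 0 < x \<Longrightarrow> 0 < q t x \<Longrightarrow> u t x < vr t x \<Longrightarrow>
        vrt t x - d2 * vrxx t x < f2 (u t x) + \<mu> * (vr t x - u t x)"
    and interface: "\<And>t. \<tau> < t \<Longrightarrow> t \<le> T \<Longrightarrow> A < 0 \<Longrightarrow> 0 < B \<Longrightarrow> 0 < q t 0 \<Longrightarrow> u t 0 < vl t 0 \<Longrightarrow>
        vlx t 0 < \<sigma> * vrx t 0"
    and tx: "\<tau> \<le> t" "t \<le> T" "A \<le> x" "x \<le> B" "0 \<le> q t x"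
  shows "v t x \<le> u t x"
proof -
  have "continuous_on UNIV (\<lambda>p. if snd p \<le> 0 then (\<lambda>(t, x). vl t x) p else (\<lambda>(t, x). vr t x) p)"
    by (intro continuous_on_cases_le continuous_on_subset[OF cont(1)] continuous_on_subset[OF cont(2)])
      (auto intro!: continuous_intros simp: glue split: prod.splits)
  then have "continuous_on ({\<tau>..T} \<times> {A..B})
      (\<lambda>p. (if snd p \<le> 0 then (\<lambda>(t, x). vl t x) p else (\<lambda>(t, x). vr t x) p) - (\<lambda>(t, x). u t x) p)"
    using \<tau> by (intro continuous_on_diff u_cont_on) (auto elim: continuous_on_subset)
  then have z: "continuous_on ({\<tau>..T} \<times> {A..B}) (\<lambda>(t, x). v t x - u t x)"
    by (simp add: v_def case_prod_unfold cong: if_cong)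
  have "v t x - u t x \<le> 0"
  proof (rule parabolic_maximum_principle[where \<mu> = \<mu> and q = q, OF z cont(3) less_imp_le[OF \<sigma>] _ _ _ tx])
    fix t x assume *: "\<tau> < t" "t \<le> T" "A < x" "x < B" "x \<noteq> 0" "0 < q t x" "0 < v t x - u t x"
    have "t > 0" using * \<tau> by linarith
    show "\<exists>D zt zx zxx. D \<ge> 0 \<and> ((\<lambda>s. v s x - u s x) has_real_derivative zt) (at t) \<and>
          (\<forall>\<^sub>F y in nhds x. ((\<lambda>y. v t y - u t y) has_real_derivative zx y) (at y)) \<and>
          (zx has_real_derivative zxx) (at x) \<and> zt - D * zxx < \<mu> * (v t x - u t x)"
    proof (cases "x < 0")
      case True
      note D = left_derivatives[OF \<open>t > 0\<close> True]
      have "\<forall>\<^sub>F y in nhds x. y \<in> {..<0}"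
        using True by (intro eventually_nhds_in_open) auto
      then have "\<forall>\<^sub>F y in nhds x. ((\<lambda>y. v t y - u t y) has_real_derivative vlx t y - ux1 t y) (at y)"
        using D(2)
      proof eventually_elim
        case (elim y)
        then have "((\<lambda>y. vl t y - u t y) has_real_derivative vlx t y - ux1 t y) (at y)"
          by (intro DERIV_diff vl) auto
        then show ?case
          by (rule has_field_derivative_transform_within_open[of _ _ _ "{..<0}"]) (use elim in \<open>auto simp: v_def\<close>)
      qed
      moreover have "((\<lambda>y. vlx t y - ux1 t y) has_real_derivative vlxx t x - uxx1 t x) (at x)"
        by (intro DERIV_diff vl D(3) True)
      moreover have "((\<lambda>s. v s x - u s x) has_real_derivative vlt t x - (d1 * uxx1 t x + f1 (u t x))) (at t)"
        using True by (auto simp: v_def intro!: DERIV_diff vl D(1))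
      moreover have "vlt t x - (d1 * uxx1 t x + f1 (u t x)) - d1 * (vlxx t x - uxx1 t x) < \<mu> * (v t x - u t x)"
        using left[OF *(1-4) True *(6)] *(7) True by (simp add: v_def algebra_simps)
      ultimately show ?thesis
        using d1 by - (rule exI[of _ d1], intro exI conjI, simp, assumption+)
    next
      case False
      then have True: "x > 0" using * by simp
      note D = right_derivatives[OF \<open>t > 0\<close> True]
      have "\<forall>\<^sub>F y in nhds x. y \<in> {0<..}"
        using True by (intro eventually_nhds_in_open) auto
      then have "\<forall>\<^sub>F y in nhds x. ((\<lambda>y. v t y - u t y) has_real_derivative vrx t y - ux2 t y) (at y)"
        using D(2)
      proof eventually_elim
        case (elim y)
        then have "((\<lambda>y. vr t y - u t y) has_real_derivative vrx t y - ux2 t y) (at y)"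
          by (intro DERIV_diff vr) auto
        then show ?case
          by (rule has_field_derivative_transform_within_open[of _ _ _ "{0<..}"]) (use elim in \<open>auto simp: v_def\<close>)
      qed
      moreover have "((\<lambda>y. vrx t y - ux2 t y) has_real_derivative vrxx t x - uxx2 t x) (at x)"
        by (intro DERIV_diff vr D(3) True)
      moreover have "((\<lambda>s. v s x - u s x) has_real_derivative vrt t x - (d2 * uxx2 t x + f2 (u t x))) (at t)"
        using True by (auto simp: v_def intro!: DERIV_diff vr D(1))
      moreover have "vrt t x - (d2 * uxx2 t x + f2 (u t x)) - d2 * (vrxx t x - uxx2 t x) < \<mu> * (v t x - u t x)"
        using right[OF *(1-4) True *(6)] *(7) True by (simp add: v_def algebra_simps)
      ultimately show ?thesis
        using d2 by - (rule exI[of _ d2], intro exI conjI, simp, assumption+)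
    qed
  next
    fix t assume *: "\<tau> < t" "t \<le> T" "A < 0" "0 < B" "0 < q t 0" "0 < v t 0 - u t 0"
    have "t > 0" using * \<tau> by linarith
    note D = interface_derivatives[OF \<open>t > 0\<close>]
    have "((\<lambda>y. vl t y - u t y) has_real_derivative vlx t 0 - ux1 t 0) (at 0 within {..0})"
      by (intro DERIV_diff D has_field_derivative_at_within[OF vl(2)]) simp
    then have l: "((\<lambda>y. v t y - u t y) has_real_derivative vlx t 0 - ux1 t 0) (at 0 within {..0})"
      by (rule has_field_derivative_transform_within[where d = 1]) (auto simp: v_def)
    have "((\<lambda>y. vr t y - u t y) has_real_derivative vrx t 0 - ux2 t 0) (at 0 within {0..})"
      by (intro DERIV_diff D has_field_derivative_at_within[OF vr(2)]) simp
    then have r: "((\<lambda>y. v t y - u t y) has_real_derivative vrx t 0 - ux2 t 0) (at 0 within {0..})"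
      by (rule has_field_derivative_transform_within[where d = 1]) (use glue in \<open>auto simp: v_def\<close>)
    have "vlx t 0 - ux1 t 0 < \<sigma> * (vrx t 0 - ux2 t 0)"
      using interface[OF *(1-5)] *(6) flux[OF \<open>t > 0\<close>] by (simp add: v_def algebra_simps)
    with l r show "\<exists>l r. ((\<lambda>y. v t y - u t y) has_real_derivative l) (at 0 within {..0}) \<and>
        ((\<lambda>y. v t y - u t y) has_real_derivative r) (at 0 within {0..}) \<and> l < \<sigma> * r"
      by blast
  next
    show "t \<noteq> \<tau> \<and> x \<noteq> A \<and> x \<noteq> B \<and> q t x \<noteq> 0"
      if "\<tau> \<le> t" "t \<le> T" "A \<le> x" "x \<le> B" "0 \<le> q t x" "0 < v t x - u t x" for t x
      using bdry[OF that(1-5)] that(6) by auto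
  qed
  then show ?thesis by simp
qed

lemma upper_barrier_interval:
  fixes w wt wx wxx :: "real \<Rightarrow> real \<Rightarrow> real" and \<mu> :: real
  assumes cont: "continuous_on UNIV (\<lambda>(t, x). w t x)"
    and w: "\<And>t x. ((\<lambda>s. w s x) has_real_derivative wt t x) (at t)"
      "\<And>t x. (w t has_real_derivative wx t x) (at x)"
      "\<And>t x. (wx t has_real_derivative wxx t x) (at x)"
    and bdry: "\<And>t x. 0 \<le> t \<Longrightarrow> A \<le> x \<Longrightarrow> x \<le> 0 \<Longrightarrow> t = 0 \<or> x = A \<or> x = 0 \<Longrightarrow> u t x \<le> w t x"
    and left: "\<And>t x. 0 < t \<Longrightarrow> A < x \<Longrightarrow> x < 0 \<Longrightarrow> w t x < u t x \<Longrightarrow>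
        f1 (u t x) < wt t x - d1 * wxx t x + \<mu> * (u t x - w t x)"
    and tx: "0 \<le> t" "A \<le> x" "x \<le> 0"
  shows "u t x \<le> w t x"
proof -
  have "continuous_on ({0..t} \<times> {A..0}) (\<lambda>p. (\<lambda>(t, x). u t x) p - (\<lambda>(t, x). w t x) p)"
    by (intro continuous_on_diff continuous_on_subset[OF cont] u_cont_on) auto
  then have z: "continuous_on ({0..t} \<times> {A..0}) (\<lambda>(t, x). u t x - w t x)"
    by (simp add: case_prod_unfold)
  have one: "continuous_on UNIV (\<lambda>(t::real, x::real). 1 :: real)"
    by (simp add: case_prod_unfold)
  have "u t x - w t x \<le> 0"
  proof (rule parabolic_maximum_principle[where \<mu> = \<mu> and \<sigma> = 1 and q = "\<lambda>_ _. 1", OF z one])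
    fix s y assume *: "0 < s" "A < y" "y < 0" "0 < u s y - w s y"
    note D = left_derivatives[OF *(1,3)]
    have "\<forall>\<^sub>F y in nhds y. ((\<lambda>y. u s y - w s y) has_real_derivative ux1 s y - wx s y) (at y)"
      using D(2) by eventually_elim (intro DERIV_diff w)
    moreover have "((\<lambda>y. ux1 s y - wx s y) has_real_derivative uxx1 s y - wxx s y) (at y)"
      by (intro DERIV_diff w D(3))
    moreover have "((\<lambda>s. u s y - w s y) has_real_derivative d1 * uxx1 s y + f1 (u s y) - wt s y) (at s)"
      by (intro DERIV_diff w D(1))
    moreover have "d1 * uxx1 s y + f1 (u s y) - wt s y - d1 * (uxx1 s y - wxx s y) < \<mu> * (u s y - w s y)"
      using left[OF *(1-3)] *(4) by (simp add: algebra_simps)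
    ultimately show "\<exists>D zt zx zxx. D \<ge> 0 \<and> ((\<lambda>s. u s y - w s y) has_real_derivative zt) (at s) \<and>
          (\<forall>\<^sub>F y in nhds y. ((\<lambda>y. u s y - w s y) has_real_derivative zx y) (at y)) \<and>
          (zx has_real_derivative zxx) (at y) \<and> zt - D * zxx < \<mu> * (u s y - w s y)"
      using d1 by - (rule exI[of _ d1], intro exI conjI, simp, assumption+)
  next
    show "s \<noteq> 0 \<and> y \<noteq> A \<and> y \<noteq> 0 \<and> (1::real) \<noteq> 0"
      if "0 \<le> s" "A \<le> y" "y \<le> 0" "0 < u s y - w s y" for s y
      using bdry[OF that(1-3)] that(4) by auto
  qed (use tx in auto)
  then show ?thesis by simp
qed

text \<open>
  The barrier solves the linear equation that dominates the nonlinear one above the level \<open>k\<close>.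
  Comparison on \<open>[-L, 0]\<close> needs control of \<open>u\<close> at the artificial end \<open>-L\<close>. It is obtained
  by adding a solution of the homogeneous linear equation that is at least \<open>M\<close> there and vanishes
  as \<open>L\<close> tends to infinity.
\<close>

lemma upper_barrier_half_line:
  fixes w wt wx wxx :: "real \<Rightarrow> real \<Rightarrow> real" and a k :: real
  assumes cont: "continuous_on UNIV (\<lambda>(t, x). w t x)"
    and w: "\<And>t x. ((\<lambda>s. w s x) has_real_derivative wt t x) (at t)"
      "\<And>t x. (w t has_real_derivative wx t x) (at x)"
      "\<And>t x. (wx t has_real_derivative wxx t x) (at x)"
    and reaction: "\<And>s. k \<le> s \<Longrightarrow> s \<le> M \<Longrightarrow> f1 s \<le> a * (s - k)"
    and linear: "\<And>t x. wt t x = d1 * wxx t x + a * (w t x - k)"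
    and k: "0 \<le> k" and ge: "\<And>t x. k \<le> w t x"
    and init: "\<And>x. x \<le> 0 \<Longrightarrow> u 0 x \<le> w 0 x"
    and bdry: "\<And>t. 0 \<le> t \<Longrightarrow> u t 0 \<le> w t 0"
    and tx: "0 \<le> t" "x \<le> 0"
  shows "u t x \<le> w t x"
proof -
  \<comment> \<open>The summand 1 keeps the decay rate \<open>\<nu>\<close> positive for \<open>a = 0\<close> and the growth
    rate \<open>b = d1 * \<nu>\<^sup>2 + a\<close> nonnegative for negative \<open>a\<close>.\<close>
  define \<nu> where "\<nu> = sqrt ((\<bar>a\<bar> + 1) / d1)"
  define b where "b = \<bar>a\<bar> + 1 + a"
  have \<nu>: "\<nu> > 0" "d1 * \<nu>\<^sup>2 = \<bar>a\<bar> + 1" using d1 by (auto simp: \<nu>_def)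
  have "b \<ge> 0" by (simp add: b_def)
  define E where "E L t x = M * exp (b * t - \<nu> * (x + L))" for L t x
  have bound: "u t x \<le> w t x + E L t x" if L: "L \<ge> - x" for L
  proof (rule upper_barrier_interval[where A = "- L" and w = "\<lambda>t x. w t x + E L t x" and \<mu> = "a + 1"])
    have "continuous_on UNIV (\<lambda>p. (\<lambda>(t, x). w t x) p + M * exp (b * fst p - \<nu> * (snd p + L)))"
      by (intro continuous_intros cont)
    then show "continuous_on UNIV (\<lambda>(t, x). w t x + E L t x)"
      by (simp add: E_def case_prod_unfold)
    show "((\<lambda>s. w s x + E L s x) has_real_derivative wt t x + b * E L t x) (at t)" for t x
      by (auto simp: E_def intro!: derivative_eq_intros w)
    show "((\<lambda>x. w t x + E L t x) has_real_derivative wx t x + - \<nu> * E L t x) (at x)" for t x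
      by (auto simp: E_def intro!: derivative_eq_intros w)
    show "((\<lambda>x. wx t x + - \<nu> * E L t x) has_real_derivative wxx t x + \<nu>\<^sup>2 * E L t x) (at x)" for t x
      by (auto simp: E_def power2_eq_square intro!: derivative_eq_intros w)
    have E: "E L t x \<ge> 0" for t x using M by (simp add: E_def)
    show "u t x \<le> w t x + E L t x" if "0 \<le> t" "- L \<le> x" "x \<le> 0" "t = 0 \<or> x = - L \<or> x = 0" for t x
    proof -
      have "u t (- L) \<le> w t (- L) + E L t (- L)"
      proof -
        have "M * 1 \<le> E L t (- L)"
          unfolding E_def using M \<open>b \<ge> 0\<close> that by (intro mult_left_mono) auto
        then show ?thesis using ge[of t "- L"] k u_le_M[of t "- L"] that by linarith
      qed
      then show ?thesis using that init[of x] bdry[of t] E[of t x] by force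
    qed
    show "f1 (u t x) < wt t x + b * E L t x - d1 * (wxx t x + \<nu>\<^sup>2 * E L t x) + (a + 1) * (u t x - (w t x + E L t x))"
      if "0 < t" "x < 0" "w t x + E L t x < u t x" for t x
    proof -
      have "f1 (u t x) \<le> a * (u t x - k)"
        using that ge[of t x] E[of t x] u_le_M[of t x] by (intro reaction) auto
      moreover have "d1 * (\<nu>\<^sup>2 * E L t x) = (\<bar>a\<bar> + 1) * E L t x"
        using \<nu>(2) by (simp add: mult.assoc[symmetric])
      ultimately show ?thesis
        using linear[of t x] that(3) by (simp add: b_def algebra_simps)
    qed
  qed (use tx L in auto)
  have "((\<lambda>L. w t x + M * exp (b * t - \<nu> * x - \<nu> * L)) \<longlongrightarrow> w t x + 0) at_top"
    by (intro tendsto_add tendsto_const exp_decay \<nu>)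
  moreover have "\<forall>\<^sub>F L in at_top. u t x \<le> w t x + M * exp (b * t - \<nu> * x - \<nu> * L)"
    using eventually_ge_at_top[of "- x"]
    by eventually_elim (use bound in \<open>simp add: E_def algebra_simps\<close>)
  ultimately have "u t x \<le> w t x + 0"
    by (intro tendsto_lowerbound) auto
  then show ?thesis by simp
qed

section \<open>Upper barriers in the KPP patch\<close>

text \<open>
  With \<open>l = sqrt (r / d1)\<close> the function \<open>exp (l x + 2 r t)\<close> solves the linearised equation, and
  its level sets move to the left with speed \<open>2 r / l = 2 sqrt (d1 r)\<close>, the smallest speed that an
  exponential solution can have. The shift by \<open>L\<close> makes it at least \<open>M\<close> on the part of the patch
  where the datum may be positive, and at the interface for all times.
\<close>

lemma KPP_speed_upper_bound:
  assumes r: "r > 0" and reaction: "\<And>s. 0 \<le> s \<Longrightarrow> f1 s \<le> r * s"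
    and supp: "\<And>x. x < - L \<Longrightarrow> u0 x = 0" and "L \<ge> 0" and tx: "t \<ge> 0" "x \<le> 0"
  shows "u t x \<le> M * exp (sqrt (r / d1) * (x + L + 2 * sqrt (d1 * r) * t))"
proof -
  define l where "l = sqrt (r / d1)"
  have l: "l > 0" "d1 * l\<^sup>2 = r" using r d1 by (auto simp: l_def)
  have "sqrt (r / d1) * sqrt (d1 * r) = sqrt (r\<^sup>2)"
    using d1 by (simp only: real_sqrt_mult[symmetric]) (simp add: power2_eq_square)
  then have "l * (2 * sqrt (d1 * r)) = 2 * r"
    using r by (simp add: l_def)
  then have speed: "l * (x + L + 2 * sqrt (d1 * r) * t) = l * (x + L) + 2 * r * t" for t x
    by (metis distrib_left mult.assoc)
  define w where "w t x = M * exp (l * (x + L) + 2 * r * t)" for t x :: real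
  have "u t x \<le> w t x"
  proof (rule upper_barrier_half_line[where a = r and k = 0])
    show "continuous_on UNIV (\<lambda>(t, x). w t x)"
      unfolding w_def case_prod_unfold by (intro continuous_intros)
    show "((\<lambda>s. w s x) has_real_derivative 2 * r * w t x) (at t)" for t x
      by (auto simp: w_def intro!: derivative_eq_intros)
    show "(w t has_real_derivative l * w t x) (at x)" for t x
      unfolding w_def by (auto intro!: derivative_eq_intros)
    show "((\<lambda>x. l * w t x) has_real_derivative l\<^sup>2 * w t x) (at x)" for t x
      by (auto simp: w_def power2_eq_square intro!: derivative_eq_intros)
    show "2 * r * w t x = d1 * (l\<^sup>2 * w t x) + r * (w t x - 0)" for t x
      using l(2) by (simp add: mult.assoc[symmetric])
    show "u 0 x \<le> w 0 x" if "x \<le> 0" for x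
    proof (cases "x < - L")
      case False
      then have "M * 1 \<le> w 0 x"
        unfolding w_def using M l by (intro mult_left_mono) auto
      then show ?thesis using u_le_M[of 0 x] by simp
    qed (use supp u_init M in \<open>simp add: w_def\<close>)
    show "u t 0 \<le> w t 0" if "t \<ge> 0" for t
    proof -
      have "M * 1 \<le> w t 0"
        unfolding w_def using M l r that \<open>L \<ge> 0\<close> by (intro mult_left_mono) auto
      then show ?thesis using u_le_M[OF that, of 0] by simp
    qed
  qed (use reaction tx M in \<open>auto simp: w_def\<close>)
  then show ?thesis unfolding w_def using speed[of x t] by (simp add: l_def)
qed

text \<open>
  Above the capacity the excess \<open>u - K\<close> is a subsolution of \<open>z\<^sub>t = d1 z\<^sub>x\<^sub>x - \<kappa> z\<close>. One exponential
  solution pays for the initial datum, a stationary one for the boundary values at the interface.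
\<close>

lemma KPP_capacity_upper_bound:
  assumes \<kappa>: "\<kappa> > 0" and K: "K \<ge> 0" and reaction: "\<And>s. K \<le> s \<Longrightarrow> s \<le> M \<Longrightarrow> f1 s \<le> - \<kappa> * (s - K)"
    and tx: "t \<ge> 0" "x \<le> 0"
  shows "u t x \<le> K + M * exp (- \<kappa> * t) + M * exp (sqrt (\<kappa> / d1) * x)"
proof -
  define l where "l = sqrt (\<kappa> / d1)"
  have l: "l > 0" "d1 * l\<^sup>2 = \<kappa>" using \<kappa> d1 by (auto simp: l_def)
  define w where "w t x = K + M * exp (- \<kappa> * t) + M * exp (l * x)" for t x :: real
  have "u t x \<le> w t x"
  proof (rule upper_barrier_half_line[where a = "- \<kappa>" and k = K])
    show "continuous_on UNIV (\<lambda>(t, x). w t x)"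
      unfolding w_def case_prod_unfold by (intro continuous_intros)
    show "((\<lambda>s. w s x) has_real_derivative - \<kappa> * (M * exp (- \<kappa> * t))) (at t)" for t x
      by (auto simp: w_def intro!: derivative_eq_intros)
    show "(w t has_real_derivative l * (M * exp (l * x))) (at x)" for t x
      unfolding w_def by (auto intro!: derivative_eq_intros)
    show "((\<lambda>x. l * (M * exp (l * x))) has_real_derivative l\<^sup>2 * (M * exp (l * x))) (at x)" for t x
      by (auto simp: power2_eq_square intro!: derivative_eq_intros)
    show "- \<kappa> * (M * exp (- \<kappa> * t)) = d1 * (l\<^sup>2 * (M * exp (l * x))) + - \<kappa> * (w t x - K)" for t x
      using l(2) by (simp add: w_def algebra_simps)
    show "u 0 x \<le> w 0 x" if "x \<le> 0" for x
      using u_le_M[of 0 x] mult_nonneg_nonneg[of M "exp (l * x)"] M K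
      unfolding w_def mult_zero_right exp_zero mult_1_right by (smt (verit) exp_ge_zero)
    show "u t 0 \<le> w t 0" if "t \<ge> 0" for t
      using u_le_M[OF that, of 0] mult_nonneg_nonneg[of M "exp (- \<kappa> * t)"] M K
      unfolding w_def mult_zero_right exp_zero mult_1_right by (smt (verit) exp_ge_zero)
  qed (use reaction tx M K in \<open>auto simp: w_def\<close>)
  then show ?thesis by (simp add: w_def l_def)
qed

end

section \<open>Strict positivity\<close>

text \<open>
  A quartic bump in the coordinate \<open>p * x\<close>, centred at \<open>k\<close>, whose radius \<open>\<rho> + c * t\<close> grows
  with speed \<open>c\<close>. It is meant for \<open>\<bar>p * x - k\<bar> \<le> \<rho> + c * t\<close>.
\<close>

definition spreading_bump ::
  "real \<Rightarrow> real \<Rightarrow> real \<Rightarrow> real \<Rightarrow> real \<Rightarrow> real \<Rightarrow> real \<Rightarrow> real \<Rightarrow> real" where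
  "spreading_bump \<epsilon> \<Lambda> \<rho> c k p t x = \<epsilon> * exp (- \<Lambda> * t) * ((\<rho> + c * t)\<^sup>2 - (p * x - k)\<^sup>2)\<^sup>2"

lemma spreading_bump_derivatives:
  defines "\<psi> \<equiv> \<lambda>\<rho> c k p t x. (\<rho> + c * t)\<^sup>2 - (p * x - k)\<^sup>2"
  shows "((\<lambda>s. spreading_bump \<epsilon> \<Lambda> \<rho> c k p s x) has_real_derivative
      \<epsilon> * exp (- \<Lambda> * t) * (4 * c * (\<rho> + c * t) * \<psi> \<rho> c k p t x - \<Lambda> * (\<psi> \<rho> c k p t x)\<^sup>2)) (at t)"
    and "(spreading_bump \<epsilon> \<Lambda> \<rho> c k p t has_real_derivative
      \<epsilon> * exp (- \<Lambda> * t) * (- 4 * p * (p * x - k) * \<psi> \<rho> c k p t x)) (at x)"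
    and "((\<lambda>x. \<epsilon> * exp (- \<Lambda> * t) * (- 4 * p * (p * x - k) * \<psi> \<rho> c k p t x)) has_real_derivative
      \<epsilon> * exp (- \<Lambda> * t) * p\<^sup>2 * (8 * (\<rho> + c * t)\<^sup>2 - 12 * \<psi> \<rho> c k p t x)) (at x)"
  unfolding \<psi>_def spreading_bump_def
  by (auto intro!: derivative_eq_intros simp: algebra_simps power2_eq_square)

text \<open>
  Here \<open>\<psi>\<close> is the base of the quartic bump, \<open>r\<close> its radius, \<open>D\<close> the diffusivity in the stretched
  coordinate and \<open>exp e\<close> the factor depending on time. Close to the edge of the support the term
  \<open>8 D r\<^sup>2\<close> from diffusion wins for every speed, as the other terms vanish with \<open>\<psi>\<close>; away from the
  edge \<open>\<psi>\<close> is bounded below and damping by a large \<open>\<Lambda>\<close> wins. The bound on \<open>\<Lambda>\<close> is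
  the discriminant condition for this quadratic inequality in \<open>\<psi>\<close>.
\<close>

lemma spreading_bump_subsolution:
  fixes \<psi> :: real
  assumes \<epsilon>: "\<epsilon> > 0" and D: "D > 0" and \<rho>: "0 < \<rho>" "\<rho> \<le> r" "r \<le> R" and c: "c \<ge> 0"
    and \<Lambda>: "\<Lambda> \<ge> m + (4 * c * R + 12 * D)\<^sup>2 / (32 * D * \<rho>\<^sup>2)" and \<psi>: "0 < \<psi>"
  shows "\<epsilon> * exp e * (4 * c * r * \<psi> - \<Lambda> * \<psi>\<^sup>2) - \<epsilon> * exp e * D * (8 * r\<^sup>2 - 12 * \<psi>)
    \<le> - m * (\<epsilon> * exp e * \<psi>\<^sup>2)"
proof -
  define C where "C = 4 * c * R + 12 * D"
  define a where "a = C\<^sup>2 / (32 * D * \<rho>\<^sup>2)"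
  have pos: "32 * D * \<rho>\<^sup>2 > 0" using D \<rho> by simp
  have "C > 0" using D c \<rho> by (simp add: C_def add_nonneg_pos)
  have "a > 0" using \<open>C > 0\<close> pos by (simp add: a_def)
  have "a * (32 * D * \<rho>\<^sup>2) = C\<^sup>2" using D \<rho> by (simp add: a_def)
  then have a: "a * (8 * D * \<rho>\<^sup>2) = C\<^sup>2 / 4" by simp
  have "0 \<le> (a * \<psi> - C / 2)\<^sup>2" by simp
  also have "\<dots> = a * (a * \<psi>\<^sup>2 - C * \<psi> + 8 * D * \<rho>\<^sup>2)"
    using a by (simp add: power2_eq_square algebra_simps)
  finally have 1: "0 \<le> a * \<psi>\<^sup>2 - C * \<psi> + 8 * D * \<rho>\<^sup>2"
    using \<open>a > 0\<close> by (simp add: zero_le_mult_iff)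
  have 2: "c * r * \<psi> \<le> c * R * \<psi>"
    using c \<rho> \<psi> by (intro mult_right_mono mult_left_mono) auto
  have 3: "D * \<rho>\<^sup>2 \<le> D * r\<^sup>2"
    using D \<rho> by (intro mult_left_mono power_mono) auto
  have 4: "(m + a) * \<psi>\<^sup>2 \<le> \<Lambda> * \<psi>\<^sup>2"
    using \<Lambda> by (intro mult_right_mono) (auto simp: a_def C_def)
  have "4 * c * r * \<psi> - \<Lambda> * \<psi>\<^sup>2 - D * (8 * r\<^sup>2 - 12 * \<psi>) + m * \<psi>\<^sup>2 \<le> 0"
    using 1 2 3 4 by (simp add: C_def algebra_simps)
  then have "\<epsilon> * exp e * (4 * c * r * \<psi> - \<Lambda> * \<psi>\<^sup>2 - D * (8 * r\<^sup>2 - 12 * \<psi>) + m * \<psi>\<^sup>2) \<le> 0"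
    using \<epsilon> by (intro mult_nonneg_nonpos) auto
  then show ?thesis by (simp add: algebra_simps)
qed

context two_patch_solution
begin

text \<open>
  Both reactions are at least \<open>- m u\<close>, so a bump spreading from a point \<open>x0\<close> where the datum is
  positive stays below the solution; its speed is chosen so large that it has reached \<open>x\<close> at
  time \<open>t\<close>.

  To let the bump cross the interface, it is taken in the coordinate \<open>stretch\<close>, with slope \<open>p\<close> on
  the left patch and \<open>1\<close> on the right one. At the interface the one-sided derivatives of the
  bump are in the ratio \<open>p\<close>, and both have the sign of \<open>k\<close>, the stretched position of \<open>x0\<close>. The
  flux inequality therefore amounts to \<open>k * (p - \<sigma>) < 0\<close>, which dictates whether \<open>p\<close> is taken
  above or below \<open>\<sigma>\<close>. The point \<open>x0\<close> must not be the interface itself, where \<open>k\<close> would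
  vanish.
\<close>

lemma strictly_positive:
  assumes m: "m > 0"
    and f1: "\<And>s. 0 \<le> s \<Longrightarrow> s \<le> M \<Longrightarrow> - m * s \<le> f1 s"
    and f2: "\<And>s. 0 \<le> s \<Longrightarrow> s \<le> M \<Longrightarrow> - m * s \<le> f2 s"
    and x0: "u0 x0 > 0" "x0 \<noteq> 0" and t: "t > 0"
  shows "u t x > 0"
proof -
  define p where "p = (if x0 < 0 then 2 * \<sigma> else \<sigma> / 2)"
  define stretch where "stretch x = p * min x 0 + max x 0" for x
  define k where "k = stretch x0"
  have p: "p > 0" using \<sigma> by (simp add: p_def)
  have flux_gap: "k * (p - \<sigma>) < 0"
  proof (cases "x0 < 0")
    case True
    then have "k < 0" "p - \<sigma> > 0" using \<sigma> p by (auto simp: k_def stretch_def p_def mult_less_0_iff)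
    then show ?thesis by (simp add: mult_neg_pos)
  next
    case False
    then have "k > 0" "p - \<sigma> < 0" using \<sigma> p x0 by (auto simp: k_def stretch_def p_def)
    then show ?thesis by (simp add: mult_pos_neg)
  qed
  have stretch_simps: "x \<le> 0 \<Longrightarrow> stretch x = p * x" "x \<ge> 0 \<Longrightarrow> stretch x = x" for x
    by (auto simp: stretch_def)

  have "isCont u0 x0"
    using u_cont_space[of 0 UNIV] by (simp add: continuous_on_eq_continuous_at u_init)
  then have "(u0 \<longlongrightarrow> u0 x0) (nhds x0)" by (simp add: isCont_def tendsto_nhds_iff)
  from order_tendstoD(1)[OF this, of "u0 x0 / 2"] x0
  obtain e where e: "e > 0" "\<And>y. \<bar>y - x0\<bar> < e \<Longrightarrow> u0 x0 / 2 < u0 y"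
    by (auto simp: eventually_nhds_metric dist_real_def)
  \<comment> \<open>The stretched coordinate expands distances at least by the factor \<open>h\<close>.\<close>
  define h where "h = min p 1"
  have h: "0 < h" "h \<le> p" "h \<le> 1" using p by (auto simp: h_def)
  have stretch_mono: "h * (y - y') \<le> stretch y - stretch y'" if "y' \<le> y" for y y'
  proof -
    have "h * (min y 0 - min y' 0) \<le> p * (min y 0 - min y' 0)"
      using h that by (intro mult_right_mono) auto
    moreover have "h * (max y 0 - max y' 0) \<le> 1 * (max y 0 - max y' 0)"
      using h that by (intro mult_right_mono) auto
    moreover have "h * (y - y') = h * (min y 0 - min y' 0) + h * (max y 0 - max y' 0)"
      unfolding distrib_left[symmetric] by (simp add: min_def max_def)
    ultimately show ?thesis unfolding stretch_def by (simp add: algebra_simps)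
  qed
  have stretch_dist: "h * \<bar>y - y'\<bar> \<le> \<bar>stretch y - stretch y'\<bar>" for y y'
  proof (cases "y' \<le> y")
    case True
    then show ?thesis using stretch_mono[OF True] by (simp add: abs_of_nonneg)
  next
    case False
    then have "h * (y' - y) \<le> stretch y' - stretch y" by (intro stretch_mono) simp
    then show ?thesis using False by (simp add: abs_of_neg)
  qed
  define \<rho> where "\<rho> = h * e / 2"
  have \<rho>: "\<rho> > 0" using h e by (simp add: \<rho>_def)
  have near: "u0 x0 / 2 < u0 y" if "\<bar>stretch y - k\<bar> \<le> \<rho>" for y
  proof -
    have "h * \<bar>y - x0\<bar> \<le> h * (e / 2)"
      using stretch_dist[of y x0] that by (simp add: k_def \<rho>_def)
    then have "\<bar>y - x0\<bar> \<le> e / 2" using h by simp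
    then show ?thesis using e by (intro e(2)) linarith
  qed

  define c where "c = (\<bar>stretch x - k\<bar> + 1) / t"
  define R where "R = \<rho> + c * t"
  have c: "c > 0" "c * t = \<bar>stretch x - k\<bar> + 1" using t by (auto simp: c_def add_nonneg_pos)
  \<comment> \<open>\<open>B\<close> is so large that the support has not reached \<open>B\<close> or \<open>- B\<close> by time \<open>t\<close>.\<close>
  define B where "B = (R + \<bar>stretch x - k\<bar> + \<bar>x\<bar> + \<bar>x0\<bar> + 1) / h + \<bar>x\<bar> + \<bar>x0\<bar> + 1"
  define \<epsilon> where "\<epsilon> = u0 x0 / 2 / \<rho>^4"
  have \<epsilon>: "\<epsilon> > 0" "\<epsilon> * \<rho>^4 = u0 x0 / 2" using x0 \<rho> by (auto simp: \<epsilon>_def)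
  define D1 where "D1 = d1 * p\<^sup>2"
  have D1: "D1 > 0" using d1 p by (simp add: D1_def)
  define \<Lambda> where "\<Lambda> = m + (4 * c * R + 12 * D1)\<^sup>2 / (32 * D1 * \<rho>\<^sup>2) + (4 * c * R + 12 * d2)\<^sup>2 / (32 * d2 * \<rho>\<^sup>2)"
  have \<Lambda>: "\<Lambda> \<ge> m + (4 * c * R + 12 * D1)\<^sup>2 / (32 * D1 * \<rho>\<^sup>2)" "\<Lambda> \<ge> m + (4 * c * R + 12 * d2)\<^sup>2 / (32 * d2 * \<rho>\<^sup>2)"
    "\<Lambda> > 0"
    using D1 d2 m by (auto simp: \<Lambda>_def add_pos_nonneg)
  define b where "b = spreading_bump \<epsilon> \<Lambda> \<rho> c k"
  define q where "q t x = (\<rho> + c * t)\<^sup>2 - (stretch x - k)\<^sup>2" for t x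
  have range: "\<rho> \<le> \<rho> + c * s" "\<rho> + c * s \<le> R" if "0 \<le> s" "s \<le> t" for s
    using that c mult_left_mono[of s t c] by (auto simp: R_def)
  have far: "q s y < 0" if "0 \<le> s" "s \<le> t" "\<bar>y\<bar> = B" for s y
  proof -
    have "R \<ge> 0" using range[of t] \<rho> t by simp
    have "B - \<bar>x0\<bar> \<ge> (R + \<bar>stretch x - k\<bar> + \<bar>x\<bar> + \<bar>x0\<bar> + 1) / h" by (simp add: B_def)
    also have "(R + \<bar>stretch x - k\<bar> + \<bar>x\<bar> + \<bar>x0\<bar> + 1) / h \<ge> (R + 1) / h"
      using h by (intro divide_right_mono) auto
    finally have "(R + 1) / h \<le> \<bar>y - x0\<bar>" using that by linarith
    then have "R + 1 \<le> h * \<bar>y - x0\<bar>" using h by (simp add: field_simps)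
    then have "R < \<bar>stretch y - k\<bar>" using stretch_dist[of y x0] by (simp add: k_def)
    then have "(\<rho> + c * s)\<^sup>2 < \<bar>stretch y - k\<bar>\<^sup>2"
      using range[OF that(1,2)] \<rho> by (intro power_strict_mono) auto
    then show ?thesis by (simp add: q_def)
  qed
  have "B \<ge> \<bar>x\<bar>"
  proof -
    have "R \<ge> 0" using range[of t] \<rho> t by simp
    then have "0 \<le> (R + \<bar>stretch x - k\<bar> + \<bar>x\<bar> + \<bar>x0\<bar> + 1) / h"
      using h by (intro divide_nonneg_pos) auto
    then show ?thesis by (simp add: B_def)
  qed
  have q_pos: "q t x > 0"
  proof -
    have "\<bar>stretch x - k\<bar>\<^sup>2 < (\<rho> + c * t)\<^sup>2"
      using c \<rho> by (intro power_strict_mono) auto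
    then show ?thesis by (simp add: q_def)
  qed
  have b_eq: "b (if x \<le> 0 then p else 1) s x = \<epsilon> * exp (- \<Lambda> * s) * (q s x)\<^sup>2" for s x
    by (simp add: b_def spreading_bump_def q_def stretch_def)
  have "(if x \<le> 0 then b p t x else b 1 t x) \<le> u t x"
  proof (rule lower_barrier[where q = q and \<mu> = 0 and A = "- B" and B = B and \<tau> = 0 and T = t and t = t and x = x
          and vl = "b p" and vr = "b 1",
          OF order_refl _ _ _
            spreading_bump_derivatives[where \<epsilon> = \<epsilon> and \<Lambda> = \<Lambda> and \<rho> = \<rho> and c = c and k = k and p = p, folded b_def]
            spreading_bump_derivatives[where \<epsilon> = \<epsilon> and \<Lambda> = \<Lambda> and \<rho> = \<rho> and c = c and k = k and p = 1, folded b_def]])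
    show "continuous_on UNIV (\<lambda>(t, x). b p t x)" "continuous_on UNIV (\<lambda>(t, x). b 1 t x)"
      "continuous_on UNIV (\<lambda>(t, x). q t x)"
      unfolding b_def spreading_bump_def q_def stretch_def case_prod_unfold
      by (intro continuous_intros)+
    show "b p t 0 = b 1 t 0" for t by (simp add: b_def spreading_bump_def)
    show "(if y \<le> 0 then b p s y else b 1 s y) \<le> u s y"
      if "0 \<le> s" "s \<le> t" "- B \<le> y" "y \<le> B" "0 \<le> q s y" "s = 0 \<or> y = - B \<or> y = B \<or> q s y = 0" for s y
    proof -
      have v: "(if y \<le> 0 then b p s y else b 1 s y) = \<epsilon> * exp (- \<Lambda> * s) * (q s y)\<^sup>2"
        using b_eq[of y s] by (auto split: if_splits)
      note at_edge = that(6)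
      consider "s = 0" | "\<bar>y\<bar> = B" | "q s y = 0"
        using at_edge \<open>B \<ge> \<bar>x\<bar>\<close> by (elim disjE) auto
      then show ?thesis
      proof cases
        case 1
        have q: "0 \<le> q 0 y" "q 0 y = \<rho>\<^sup>2 - (stretch y - k)\<^sup>2" using that 1 by (auto simp: q_def)
        then have "\<bar>stretch y - k\<bar> \<le> \<rho>" using \<rho> by (simp add: abs_le_square_iff[symmetric])
        from near[OF this] have "u0 x0 / 2 \<le> u0 y" by simp
        moreover have "(q 0 y)\<^sup>2 \<le> (\<rho>\<^sup>2)\<^sup>2" using q by (intro power_mono) auto
        then have "\<epsilon> * (q 0 y)\<^sup>2 \<le> \<epsilon> * \<rho>^4" using \<epsilon> by simp
        ultimately show ?thesis using \<epsilon>(2) v 1 by (simp add: u_init)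
      qed (use far[of s y] u_nonneg[of s y] v that in auto)
    qed
    show "\<epsilon> * exp (- \<Lambda> * s) * (4 * c * (\<rho> + c * s) * ((\<rho> + c * s)\<^sup>2 - (p * y - k)\<^sup>2) -
             \<Lambda> * ((\<rho> + c * s)\<^sup>2 - (p * y - k)\<^sup>2)\<^sup>2) -
          d1 * (\<epsilon> * exp (- \<Lambda> * s) * p\<^sup>2 * (8 * (\<rho> + c * s)\<^sup>2 - 12 * ((\<rho> + c * s)\<^sup>2 - (p * y - k)\<^sup>2)))
          < f1 (u s y) + 0 * (b p s y - u s y)"
      if "0 < s" "s \<le> t" "y < 0" "0 < q s y" "u s y < b p s y" for s y
    proof -
      define \<psi> where "\<psi> = (\<rho> + c * s)\<^sup>2 - (p * y - k)\<^sup>2"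
      have "\<psi> > 0" using that by (simp add: \<psi>_def q_def stretch_simps)
      have "\<epsilon> * exp (- \<Lambda> * s) * (4 * c * (\<rho> + c * s) * \<psi> - \<Lambda> * \<psi>\<^sup>2)
          - \<epsilon> * exp (- \<Lambda> * s) * D1 * (8 * (\<rho> + c * s)\<^sup>2 - 12 * \<psi>)
          \<le> - m * (\<epsilon> * exp (- \<Lambda> * s) * \<psi>\<^sup>2)"
        by (rule spreading_bump_subsolution[OF \<epsilon>(1) D1 \<rho> range _ \<Lambda>(1) \<open>\<psi> > 0\<close>]) (use that c in auto)
      also have "\<dots> = - m * b p s y" by (simp add: b_def spreading_bump_def \<psi>_def)
      also have "\<dots> < - m * u s y" using that m by simp
      also have "\<dots> \<le> f1 (u s y)" using that u_nonneg u_le_M by (intro f1) auto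
      finally show ?thesis by (simp add: \<psi>_def D1_def algebra_simps)
    qed
    show "\<epsilon> * exp (- \<Lambda> * s) * (4 * c * (\<rho> + c * s) * ((\<rho> + c * s)\<^sup>2 - (1 * y - k)\<^sup>2) -
             \<Lambda> * ((\<rho> + c * s)\<^sup>2 - (1 * y - k)\<^sup>2)\<^sup>2) -
          d2 * (\<epsilon> * exp (- \<Lambda> * s) * 1\<^sup>2 * (8 * (\<rho> + c * s)\<^sup>2 - 12 * ((\<rho> + c * s)\<^sup>2 - (1 * y - k)\<^sup>2)))
          < f2 (u s y) + 0 * (b 1 s y - u s y)"
      if "0 < s" "s \<le> t" "0 < y" "0 < q s y" "u s y < b 1 s y" for s y
    proof -
      define \<psi> where "\<psi> = (\<rho> + c * s)\<^sup>2 - (1 * y - k)\<^sup>2"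
      have "\<psi> > 0" using that by (simp add: \<psi>_def q_def stretch_simps)
      have "\<epsilon> * exp (- \<Lambda> * s) * (4 * c * (\<rho> + c * s) * \<psi> - \<Lambda> * \<psi>\<^sup>2)
          - \<epsilon> * exp (- \<Lambda> * s) * d2 * (8 * (\<rho> + c * s)\<^sup>2 - 12 * \<psi>)
          \<le> - m * (\<epsilon> * exp (- \<Lambda> * s) * \<psi>\<^sup>2)"
        by (rule spreading_bump_subsolution[OF \<epsilon>(1) d2 \<rho> range _ \<Lambda>(2) \<open>\<psi> > 0\<close>]) (use that c in auto)
      also have "\<dots> = - m * b 1 s y" by (simp add: b_def spreading_bump_def \<psi>_def)
      also have "\<dots> < - m * u s y" using that m by simp
      also have "\<dots> \<le> f2 (u s y)" using that u_nonneg u_le_M by (intro f2) auto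
      finally show ?thesis by (simp add: \<psi>_def algebra_simps)
    qed
    show "\<epsilon> * exp (- \<Lambda> * s) * (- 4 * p * (p * 0 - k) * ((\<rho> + c * s)\<^sup>2 - (p * 0 - k)\<^sup>2))
        < \<sigma> * (\<epsilon> * exp (- \<Lambda> * s) * (- 4 * 1 * (1 * 0 - k) * ((\<rho> + c * s)\<^sup>2 - (1 * 0 - k)\<^sup>2)))"
      if "0 < q s 0" for s
    proof -
      have "\<epsilon> * exp (- \<Lambda> * s) * 4 * q s 0 * (k * (p - \<sigma>)) < 0"
        by (rule mult_pos_neg[OF _ flux_gap]) (use \<epsilon> that in simp)
      then show ?thesis by (simp add: q_def stretch_simps algebra_simps)
    qed
  qed (use t \<open>B \<ge> \<bar>x\<bar>\<close> q_pos in auto)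
  moreover have "(if x \<le> 0 then b p t x else b 1 t x) = \<epsilon> * exp (- \<Lambda> * t) * (q t x)\<^sup>2"
    using b_eq[of x t] by (auto split: if_splits)
  moreover have "\<epsilon> * exp (- \<Lambda> * t) * (q t x)\<^sup>2 > 0" using \<epsilon> q_pos by simp
  ultimately show ?thesis by linarith
qed

section \<open>Lower barriers\<close>

text \<open>
  In the frame \<open>y = x + R + c' (t - t0)\<close> moving to the left, the factor \<open>exp (\<beta> y)\<close> with
  \<open>\<beta> = c' / (2 d1)\<close> removes the transport term at the cost of the growth rate \<open>c'\<^sup>2 / (4 d1)\<close>. What
  remains is the Dirichlet eigenfunction \<open>cos (\<omega> y)\<close> of \<open>[-R, R]\<close>. The bump is a subsolution of
  \<open>v\<^sub>t = d1 v\<^sub>x\<^sub>x + g v\<close> if both costs together do not exceed \<open>g\<close>, and of the nonlinear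
  equation if its height stays in the range where \<open>f1 s \<ge> g s\<close>. The height \<open>\<eta>\<close> at the centre does
  not depend on \<open>c'\<close>, hence the bound is uniform over all admissible speeds.
\<close>

lemma moving_bump_lower_bound:
  assumes \<omega>: "\<omega> > 0" and g: "d1 * \<omega>\<^sup>2 + c\<^sup>2 / (4 * d1) \<le> g" and R: "R = pi / (2 * \<omega>)"
    and reaction: "\<And>s. 0 \<le> s \<Longrightarrow> s \<le> s0 \<Longrightarrow> g * s \<le> f1 s"
    and \<eta>: "\<eta> > 0" "\<eta> * exp (c * R / (2 * d1)) \<le> s0"
    and t0: "t0 \<ge> 0" and init: "\<And>x. - 2 * R \<le> x \<Longrightarrow> x \<le> 0 \<Longrightarrow> \<eta> * exp (c * R / (2 * d1)) \<le> u t0 x"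
    and c': "0 \<le> c'" "c' \<le> c" and t: "t \<ge> t0"
  shows "\<eta> \<le> u t (- R - c' * (t - t0))"
proof -
  define \<beta> where "\<beta> = c' / (2 * d1)"
  have \<beta>: "\<beta> \<ge> 0" "2 * d1 * \<beta> = c'" "\<beta> \<le> c / (2 * d1)"
    using d1 c' by (auto simp: \<beta>_def divide_right_mono)
  have "R > 0" using R \<omega> by simp
  have \<omega>R: "\<omega> * R = pi / 2" using R \<omega> by simp
  define y where "y t x = x + R + c' * (t - t0)" for t x
  define v where "v t x = \<eta> * exp (\<beta> * y t x) * cos (\<omega> * y t x)" for t x
  define vx where "vx t x = \<eta> * exp (\<beta> * y t x) * (\<beta> * cos (\<omega> * y t x) - \<omega> * sin (\<omega> * y t x))" for t x
  define vxx where "vxx t x = \<eta> * exp (\<beta> * y t x) *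
      ((\<beta>\<^sup>2 - \<omega>\<^sup>2) * cos (\<omega> * y t x) - 2 * \<beta> * \<omega> * sin (\<omega> * y t x))" for t x
  have dt: "((\<lambda>s. v s x) has_real_derivative c' * vx t x) (at t)" for t x
    unfolding v_def vx_def y_def by (auto intro!: derivative_eq_intros simp: algebra_simps)
  have dx: "(v t has_real_derivative vx t x) (at x)" for t x
    unfolding v_def vx_def y_def by (auto intro!: derivative_eq_intros simp: algebra_simps)
  have dxx: "(vx t has_real_derivative vxx t x) (at x)" for t x
    unfolding vx_def vxx_def y_def
    by (auto intro!: derivative_eq_intros simp: algebra_simps power2_eq_square)
  have pde: "c' * vx t x - d1 * vxx t x = (d1 * \<omega>\<^sup>2 + c'\<^sup>2 / (4 * d1)) * v t x" for t x
  proof -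
    have "c'\<^sup>2 / (4 * d1) = d1 * \<beta>\<^sup>2" using d1 by (simp add: \<beta>_def power2_eq_square)
    then show ?thesis
      unfolding v_def vx_def vxx_def \<beta>(2)[symmetric] by (simp add: algebra_simps power2_eq_square)
  qed
  have rate: "d1 * \<omega>\<^sup>2 + c'\<^sup>2 / (4 * d1) \<le> g"
  proof -
    have "c'\<^sup>2 / (4 * d1) \<le> c\<^sup>2 / (4 * d1)" using c' d1 by (intro divide_right_mono power_mono) auto
    then show ?thesis using g by linarith
  qed
  have inside: "0 \<le> v t x \<and> v t x \<le> \<eta> * exp (c * R / (2 * d1))" if "\<bar>y t x\<bar> \<le> R" for t x
  proof -
    have "\<bar>\<omega> * y t x\<bar> \<le> pi / 2" using that \<omega> \<omega>R by (simp add: abs_mult flip: \<omega>R)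
    then have "0 \<le> cos (\<omega> * y t x)" by (intro cos_ge_zero) auto
    moreover have "\<beta> * y t x \<le> c * R / (2 * d1)"
    proof -
      have "\<beta> * y t x \<le> \<beta> * R" using that \<beta> by (intro mult_left_mono) auto
      also have "\<dots> \<le> c / (2 * d1) * R" using \<beta> \<open>R > 0\<close> by (intro mult_right_mono) auto
      finally show ?thesis by simp
    qed
    then have "\<eta> * exp (\<beta> * y t x) * cos (\<omega> * y t x) \<le> \<eta> * exp (c * R / (2 * d1)) * 1"
      using \<eta> \<open>0 \<le> cos (\<omega> * y t x)\<close> by (intro mult_mono) auto
    ultimately show ?thesis using \<eta> by (simp add: v_def)
  qed
  have edge: "v t x = 0" if "\<bar>y t x\<bar> = R" for t x
  proof -
    have "\<bar>\<omega> * y t x\<bar> = pi / 2" using that \<omega> \<omega>R by (simp add: abs_mult)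
    then have "\<omega> * y t x = pi / 2 \<or> \<omega> * y t x = - (pi / 2)" by linarith
    then have "cos (\<omega> * y t x) = 0" by (metis cos_minus cos_pi_half)
    then show ?thesis by (simp add: v_def)
  qed
  define x where "x = - R - c' * (t - t0)"
  define A where "A = - 2 * R - c' * (t - t0) - 1"
  have x: "x \<le> 0" "A \<le> x" "y t x = 0"
    unfolding x_def A_def y_def using \<open>R > 0\<close> mult_nonneg_nonneg[of c' "t - t0"] c' t by linarith+
  \<comment> \<open>The domain stays in the left patch, so one formula can serve for both patches.\<close>
  have "(if x \<le> 0 then v t x else v t x) \<le> u t x"
  proof (rule lower_barrier[where q = "\<lambda>t x. R - \<bar>y t x\<bar>" and \<mu> = "g + 1" and A = A and B = 0 and \<tau> = t0 and T = t and t = t and x = x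
          and vl = v and vlt = "\<lambda>t x. c' * vx t x" and vlx = vx and vlxx = vxx
          and vr = v and vrt = "\<lambda>t x. c' * vx t x" and vrx = vx and vrxx = vxx,
          OF t0 _ _ _ dt dx dxx dt dx dxx])
    show "continuous_on UNIV (\<lambda>(t, x). v t x)" "continuous_on UNIV (\<lambda>(t, x). v t x)"
      "continuous_on UNIV (\<lambda>(t, x). R - \<bar>y t x\<bar>)"
      unfolding v_def y_def case_prod_unfold by (intro continuous_intros)+
    show "(if z \<le> 0 then v s z else v s z) \<le> u s z"
      if *: "t0 \<le> s" "s \<le> t" "A \<le> z" "z \<le> 0" "0 \<le> R - \<bar>y s z\<bar>"
        "s = t0 \<or> z = A \<or> z = 0 \<or> R - \<bar>y s z\<bar> = 0" for s z
    proof -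
      consider "\<bar>y s z\<bar> = R" | "s = t0" "- 2 * R \<le> z"
      proof -
        have "c' * (s - t0) \<le> c' * (t - t0)" "0 \<le> c' * (s - t0)" "s = t0 \<Longrightarrow> c' * (s - t0) = 0"
          using * c' by (auto intro: mult_left_mono)
        then have "\<bar>y s z\<bar> = R \<or> s = t0 \<and> - 2 * R \<le> z"
          using * \<open>R > 0\<close> unfolding y_def A_def by (smt (verit))
        then show ?thesis using that by blast
      qed
      then show ?thesis
      proof cases
        case 1
        then show ?thesis using edge[OF 1] u_nonneg[of s z] t0 * by simp
      next
        case 2
        then show ?thesis using inside[of s z] init[of z] * by simp
      qed
    qed
    show "c' * vx s z - d1 * vxx s z < f1 (u s z) + (g + 1) * (v s z - u s z)"
      if "t0 < s" "0 < R - \<bar>y s z\<bar>" "u s z < v s z" for s z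
    proof -
      have "0 \<le> v s z" "v s z \<le> s0" using inside[of s z] that \<eta> by auto
      then have "g * u s z \<le> f1 (u s z)"
        using that t0 u_nonneg[of s z] by (intro reaction) auto
      moreover have "c' * vx s z - d1 * vxx s z \<le> g * v s z"
        unfolding pde using rate \<open>0 \<le> v s z\<close> by (intro mult_right_mono) auto
      ultimately show ?thesis using that by (simp add: algebra_simps)
    qed
  qed (use t x \<open>R > 0\<close> in auto)
  then show ?thesis using x(3) by (simp add: v_def x_def)
qed

text \<open>
  A stationary subsolution on \<open>[-R, X]\<close> with \<open>X > b\<close>, decreasing from at most \<open>\<eta>\<close> at \<open>-R\<close> to \<open>0\<close>
  at \<open>X\<close>. On the right patch it is a shifted exponential, convex enough to absorb the loss \<open>- m s\<close>.
  On the left patch it is affine, which suffices since \<open>f1 \<ge> 0\<close> below the capacity; the slope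
  is twice the one for which the flux condition would be an equality.
\<close>

lemma interface_crossing_lower_bound:
  assumes K: "K > 0" and f1: "\<And>s. 0 \<le> s \<Longrightarrow> s \<le> K \<Longrightarrow> 0 \<le> f1 s"
    and m: "m > 0" and f2: "\<And>s. 0 \<le> s \<Longrightarrow> s \<le> M \<Longrightarrow> - m * s \<le> f2 s"
    and R: "R > 0" and \<eta>: "\<eta> > 0" and t0: "t0 \<ge> 0" and edge: "\<And>t. t \<ge> t0 \<Longrightarrow> \<eta> \<le> u t (- R)"
    and init: "\<And>x. u t0 x > 0"
  obtains \<delta> where "\<delta> > 0" "\<And>t x. t \<ge> t0 \<Longrightarrow> - R \<le> x \<Longrightarrow> x \<le> b \<Longrightarrow> \<delta> \<le> u t x"
proof -
  define X where "X = max b 0 + 1"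
  define k where "k = sqrt (m / d2)"
  have k: "k > 0" "d2 * k\<^sup>2 = m" using m d2 by (auto simp: k_def)
  have "\<exists>y\<in>{- R..X}. \<forall>x\<in>{- R..X}. u t0 y \<le> u t0 x"
    using R t0 by (intro continuous_attains_inf u_cont_space) (auto simp: X_def)
  then obtain y where y: "\<forall>x\<in>{- R..X}. u t0 y \<le> u t0 x" by blast
  define H where "H = 1 + 2 * \<sigma> * k * R"
  have H: "H > 0" using \<sigma> k R by (simp add: H_def add_pos_pos)
  define h where "h = min (min \<eta> K) (u t0 y)"
  have h: "h > 0" "h \<le> \<eta>" "h \<le> K" "\<And>x. - R \<le> x \<Longrightarrow> x \<le> X \<Longrightarrow> h \<le> u t0 x"
    using \<eta> K init[of y] y by (auto simp: h_def min_le_iff_disj)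
  define \<epsilon> where "\<epsilon> = h / H"
  have \<epsilon>: "\<epsilon> > 0" "\<epsilon> * H = h" using h H by (auto simp: \<epsilon>_def)
  define v1 where "v1 t x = \<epsilon> * (1 - exp (- k * X) - 2 * \<sigma> * k * x)" for t x :: real
  define v2 where "v2 t x = \<epsilon> * (exp (- k * x) - exp (- k * X))" for t x :: real
  define v where "v x = (if x \<le> 0 then v1 0 x else v2 0 x)" for x
  have v_le: "v x \<le> h" if "- R \<le> x" for x
  proof -
    have "2 * \<sigma> * k * (- x) \<le> 2 * \<sigma> * k * R" using \<sigma> k that by (intro mult_left_mono) auto
    then have 1: "1 - exp (- k * X) - 2 * \<sigma> * k * x \<le> H"
      using exp_ge_zero[of "- k * X"] unfolding H_def by linarith
    have 2: "exp (- k * x) - exp (- k * X) \<le> H" if "x > 0"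
    proof -
      have "exp (- k * x) \<le> 1" "0 \<le> exp (- k * X)" "0 < \<sigma> * k * R" using that k R \<sigma> by auto
      then show ?thesis unfolding H_def by linarith
    qed
    show ?thesis
      unfolding v_def v1_def v2_def \<epsilon>(2)[symmetric] using 1 2 \<epsilon>(1) by (auto intro!: mult_left_mono)
  qed
  have v_ge: "\<epsilon> * (exp (- k * max b 0) - exp (- k * X)) \<le> v x" if "x \<le> b" for x
  proof (cases "x \<le> 0")
    case True
    then have "\<sigma> * k * x \<le> 0" using \<sigma> k by (simp add: mult_nonneg_nonpos)
    moreover have "exp (- k * max b 0) \<le> 1" using k by simp
    ultimately have "exp (- k * max b 0) - exp (- k * X) \<le> 1 - exp (- k * X) - 2 * \<sigma> * k * x" by linarith
    then show ?thesis using True \<epsilon> by (simp add: v_def v1_def)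
  next
    case False
    then show ?thesis using that k \<epsilon> by (simp add: v_def v2_def)
  qed
  have bound: "v x \<le> u t x" if "t \<ge> t0" "- R \<le> x" "x \<le> X" for t x
  proof -
    have "(if x \<le> 0 then v1 t x else v2 t x) \<le> u t x"
    proof (rule lower_barrier[where q = "\<lambda>_ _. 1" and \<mu> = 1 and A = "- R" and B = X and \<tau> = t0 and T = t and t = t and x = x
            and vl = v1 and vlt = "\<lambda>_ _. 0" and vlx = "\<lambda>_ _. \<epsilon> * (- 2 * \<sigma> * k)" and vlxx = "\<lambda>_ _. 0"
            and vr = v2 and vrt = "\<lambda>_ _. 0" and vrx = "\<lambda>_ x. \<epsilon> * (- k * exp (- k * x))"
            and vrxx = "\<lambda>_ x. \<epsilon> * (k\<^sup>2 * exp (- k * x))", OF t0])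
      show "continuous_on UNIV (\<lambda>(t, x). v1 t x)" "continuous_on UNIV (\<lambda>(t, x). v2 t x)"
        "continuous_on UNIV (\<lambda>(t :: real, x :: real). 1 :: real)"
        unfolding v1_def v2_def case_prod_unfold by (intro continuous_intros)+
      show "((\<lambda>s. v1 s x) has_real_derivative 0) (at t)" "((\<lambda>s. v2 s x) has_real_derivative 0) (at t)" for t x
        by (simp_all add: v1_def v2_def)
      show "(v1 t has_real_derivative \<epsilon> * (- 2 * \<sigma> * k)) (at x)" for t x
        unfolding v1_def by (auto intro!: derivative_eq_intros)
      show "((\<lambda>x. \<epsilon> * (- 2 * \<sigma> * k)) has_real_derivative 0) (at x)" for x
        by simp
      show "(v2 t has_real_derivative \<epsilon> * (- k * exp (- k * x))) (at x)" for t x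
        unfolding v2_def by (auto intro!: derivative_eq_intros)
      show "((\<lambda>x. \<epsilon> * (- k * exp (- k * x))) has_real_derivative \<epsilon> * (k\<^sup>2 * exp (- k * x))) (at x)" for x
        by (auto intro!: derivative_eq_intros simp: power2_eq_square)
      show "(if z \<le> 0 then v1 s z else v2 s z) \<le> u s z"
        if "t0 \<le> s" "- R \<le> z" "z \<le> X" "s = t0 \<or> z = - R \<or> z = X \<or> (1::real) = 0" for s z
      proof -
        have "(if z \<le> 0 then v1 s z else v2 s z) = v z" by (simp add: v_def v1_def v2_def)
        moreover have "v X = 0" by (simp add: v_def v2_def X_def)
        ultimately show ?thesis
          using that v_le[of z] h edge[of s] u_nonneg[of s z] t0 by force
      qed
      show "0 - d1 * 0 < f1 (u s z) + 1 * (v1 s z - u s z)"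
        if "t0 < s" "- R < z" "z < 0" "u s z < v1 s z" for s z
      proof -
        have "v1 s z = v z" using that by (simp add: v_def v1_def)
        then have "u s z \<le> K" using v_le[of z] h that by linarith
        then have "0 \<le> f1 (u s z)" using f1 u_nonneg[of s z] that t0 by simp
        then show ?thesis using that by simp
      qed
      show "0 - d2 * (\<epsilon> * (k\<^sup>2 * exp (- k * z))) < f2 (u s z) + 1 * (v2 s z - u s z)"
        if "t0 < s" "u s z < v2 s z" for s z
      proof -
        define P where "P = \<epsilon> * exp (- k * z)"
        have eq: "d2 * (\<epsilon> * (k\<^sup>2 * exp (- k * z))) = m * P"
          unfolding k(2)[symmetric] P_def by simp
        have "v2 s z \<le> P" using \<epsilon> by (simp add: v2_def P_def)
        then have "m * u s z \<le> m * P" using that m by (intro mult_left_mono) auto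
        moreover have "- (m * u s z) \<le> f2 (u s z)"
          using f2[of "u s z"] that t0 u_nonneg[of s z] u_le_M[of s z] by simp
        ultimately have "- (m * P) \<le> f2 (u s z)" by linarith
        then have "0 - m * P \<le> f2 (u s z)" by simp
        also have "\<dots> < f2 (u s z) + 1 * (v2 s z - u s z)" using that by simp
        finally show ?thesis unfolding eq .
      qed
      show "\<epsilon> * (- 2 * \<sigma> * k) < \<sigma> * (\<epsilon> * (- k * exp (- k * 0)))"
        using \<epsilon> \<sigma> k by simp
    qed (use that in \<open>auto simp: v1_def v2_def\<close>)
    then show ?thesis by (auto simp: v_def v1_def v2_def split: if_splits)
  qed
  show ?thesis
  proof (rule that[of "\<epsilon> * (exp (- k * max b 0) - exp (- k * X))"])
    show "\<epsilon> * (exp (- k * max b 0) - exp (- k * X)) > 0" using \<epsilon> k by (simp add: X_def)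
    show "\<epsilon> * (exp (- k * max b 0) - exp (- k * X)) \<le> u t x" if "t \<ge> t0" "- R \<le> x" "x \<le> b" for t x
    proof -
      have "x \<le> X" using that by (simp add: X_def)
      then show ?thesis using v_ge[of x] bound[of t x] that by linarith
    qed
  qed
qed

text \<open>
  While \<open>u\<close> lies between \<open>\<eta>\<close> and \<open>K\<close>, the deficit \<open>K - u\<close> is a subsolution of
  \<open>z\<^sub>t = d1 z\<^sub>x\<^sub>x - \<kappa> z\<close>. The three exponentials are supersolutions of this equation, each
  equal to \<open>1\<close> on one part of the boundary: the initial time, the fixed end \<open>x = -R\<close>, and the end
  moving with speed \<open>c\<close>. For the last one the motion costs \<open>c \<nu>\<close>, whence the bound on
  \<open>d1 \<nu>\<^sup>2 + c \<nu>\<close>.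
\<close>

lemma convergence_lower_bound:
  assumes \<kappa>: "\<kappa> > 0" and K: "K > 0"
    and reaction: "\<And>s. \<eta> \<le> s \<Longrightarrow> s \<le> K \<Longrightarrow> \<kappa> * (K - s) \<le> f1 s"
    and R: "R \<ge> 0" and t0: "t0 \<ge> 0" and c: "c \<ge> 0"
    and floor: "\<And>t x. t \<ge> t0 \<Longrightarrow> - R - c * (t - t0) \<le> x \<Longrightarrow> x \<le> - R \<Longrightarrow> \<eta> \<le> u t x"
    and \<nu>: "\<nu> \<ge> 0" "d1 * \<nu>\<^sup>2 + c * \<nu> \<le> \<kappa>"
    and tx: "t \<ge> t0" "- R - c * (t - t0) \<le> x" "x \<le> - R"
  shows "K * (1 - exp (- \<kappa> * (t - t0)) - exp (\<nu> * (x + R)) - exp (- \<nu> * (x + R + c * (t - t0)))) \<le> u t x"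
proof -
  define E1 where "E1 t = exp (- \<kappa> * (t - t0))" for t
  define E2 where "E2 x = exp (\<nu> * (x + R))" for x
  define E3 where "E3 t x = exp (- \<nu> * (x + R + c * (t - t0)))" for t x
  note E_defs = E1_def E2_def E3_def
  define v where "v t x = K * (1 - E1 t - E2 x - E3 t x)" for t x
  have E_nonneg: "0 \<le> E1 t" "0 \<le> E2 x" "0 \<le> E3 t x" for t x by (auto simp: E_defs)
  have dt: "((\<lambda>s. v s x) has_real_derivative K * (\<kappa> * E1 t + c * \<nu> * E3 t x)) (at t)" for t x
    unfolding v_def E_defs by (auto intro!: derivative_eq_intros)
  have dx: "(v t has_real_derivative K * (\<nu> * E3 t x - \<nu> * E2 x)) (at x)" for t x
    unfolding v_def E_defs by (auto intro!: derivative_eq_intros)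
  have dxx: "((\<lambda>x. K * (\<nu> * E3 t x - \<nu> * E2 x)) has_real_derivative - K * \<nu>\<^sup>2 * (E3 t x + E2 x)) (at x)" for t x
    unfolding E_defs by (auto intro!: derivative_eq_intros simp: power2_eq_square algebra_simps)
  have "c * (t - t0) \<ge> 0" using c tx by simp
  \<comment> \<open>The domain stays in the left patch, so one formula can serve for both patches.\<close>
  have "(if x \<le> 0 then v t x else v t x) \<le> u t x"
  proof (rule lower_barrier[where q = "\<lambda>t x. x + R + c * (t - t0)" and \<mu> = 0 and A = "- R - c * (t - t0)"
          and B = "- R" and \<tau> = t0 and T = t and t = t and x = x
          and vl = v and vlt = "\<lambda>t x. K * (\<kappa> * E1 t + c * \<nu> * E3 t x)"
          and vlx = "\<lambda>t x. K * (\<nu> * E3 t x - \<nu> * E2 x)" and vlxx = "\<lambda>t x. - K * \<nu>\<^sup>2 * (E3 t x + E2 x)"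
          and vr = v and vrt = "\<lambda>t x. K * (\<kappa> * E1 t + c * \<nu> * E3 t x)"
          and vrx = "\<lambda>t x. K * (\<nu> * E3 t x - \<nu> * E2 x)" and vrxx = "\<lambda>t x. - K * \<nu>\<^sup>2 * (E3 t x + E2 x)",
          OF t0 _ _ _ dt dx dxx dt dx dxx])
    show "continuous_on UNIV (\<lambda>(t, x). v t x)" "continuous_on UNIV (\<lambda>(t, x). v t x)"
      "continuous_on UNIV (\<lambda>(t, x). x + R + c * (t - t0))"
      unfolding v_def E_defs case_prod_unfold by (intro continuous_intros)+
    show "(if z \<le> 0 then v s z else v s z) \<le> u s z"
      if *: "t0 \<le> s" "s \<le> t" "- R - c * (t - t0) \<le> z" "z \<le> - R" "0 \<le> z + R + c * (s - t0)"
        "s = t0 \<or> z = - R - c * (t - t0) \<or> z = - R \<or> z + R + c * (s - t0) = 0" for s z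
    proof -
      have "c * (s - t0) \<le> c * (t - t0)" using * c by (intro mult_left_mono) auto
      then consider "s = t0" | "z = - R" | "z + R + c * (s - t0) = 0" using * by force
      then have "1 \<le> E1 s + E2 z + E3 s z"
        by cases (use E_nonneg(1)[of s] E_nonneg(2)[of z] E_nonneg(3)[of s z] in \<open>simp_all add: E_defs\<close>)
      then have "v s z \<le> 0" using K by (simp add: v_def mult_le_0_iff)
      then show ?thesis using u_nonneg[of s z] t0 * by simp
    qed
    show "K * (\<kappa> * E1 s + c * \<nu> * E3 s z) - d1 * (- K * \<nu>\<^sup>2 * (E3 s z + E2 z)) < f1 (u s z) + 0 * (v s z - u s z)"
      if *: "t0 < s" "z < - R" "0 < z + R + c * (s - t0)" "u s z < v s z" for s z
    proof -
      have "v s z \<le> K * 1" unfolding v_def using K E_nonneg(1)[of s] E_nonneg(2)[of z] E_nonneg(3)[of s z] by (intro mult_left_mono) auto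
      then have "\<kappa> * (K - u s z) \<le> f1 (u s z)"
        using * by (intro reaction floor) auto
      moreover have "\<kappa> * (K - v s z) < \<kappa> * (K - u s z)" using * \<kappa> by simp
      moreover have "d1 * \<nu>\<^sup>2 * E2 z \<le> \<kappa> * E2 z"
        using \<nu> c E_nonneg by (intro mult_right_mono) (auto intro: order_trans[rotated])
      moreover have "(d1 * \<nu>\<^sup>2 + c * \<nu>) * E3 s z \<le> \<kappa> * E3 s z"
        using \<nu> E_nonneg by (intro mult_right_mono) auto
      ultimately have "K * (d1 * \<nu>\<^sup>2 * E2 z) \<le> K * (\<kappa> * E2 z)"
        "K * ((d1 * \<nu>\<^sup>2 + c * \<nu>) * E3 s z) \<le> K * (\<kappa> * E3 s z)" "\<kappa> * (K - v s z) < f1 (u s z)"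
        using K by auto
      then show ?thesis by (simp add: v_def algebra_simps)
    qed
  qed (use tx R in auto)
  then show ?thesis by (simp add: v_def E_defs)
qed

section \<open>Persistence and convergence in the KPP patch\<close>

text \<open>
  As \<open>c\<close> is smaller than the KPP speed, \<open>c\<^sup>2 / (4 d1) < f1'(0)\<close>, and there is a rate \<open>g\<close> strictly
  in between; the gap determines the width of the moving bumps. A point \<open>x\<close> at time \<open>t\<close> is
  reached by the centre of the bump with speed \<open>(- R - x) / (t - 1)\<close>.
\<close>

lemma KPP_persistence:
  assumes f1: "\<And>x. (f1 has_real_derivative deriv f1 x) (at x)" "f1 0 = 0"
    and pos: "\<And>x. u 1 x > 0" and c: "0 \<le> c" "c < KPP_speed d1 f1"
  obtains R \<eta> where "R > 0" "\<eta> > 0"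
    "\<And>t x. t \<ge> 1 \<Longrightarrow> - R - c * (t - 1) \<le> x \<Longrightarrow> x \<le> - R \<Longrightarrow> \<eta> \<le> u t x"
proof -
  define r where "r = deriv f1 0"
  have "c / 2 < sqrt (d1 * r)" using c by (simp add: KPP_speed_def r_def)
  then have "(c / 2)\<^sup>2 < (sqrt (d1 * r))\<^sup>2" using c by (intro power_strict_mono) auto
  moreover have "sqrt (d1 * r) > 0" using \<open>c / 2 < sqrt (d1 * r)\<close> c by linarith
  ultimately have "(c / 2)\<^sup>2 < d1 * r" by simp
  then have "c\<^sup>2 / (4 * d1) < r" using d1 by (simp add: field_simps power2_eq_square)
  then obtain g where g: "c\<^sup>2 / (4 * d1) < g" "g < r" using dense by blast
  obtain s where s: "s > 0" "\<And>v. 0 \<le> v \<Longrightarrow> v \<le> s \<Longrightarrow> g * v \<le> f1 v"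
    using tangent_lower_bound[OF f1 g(2)[unfolded r_def]] by blast
  define \<omega> where "\<omega> = sqrt ((g - c\<^sup>2 / (4 * d1)) / d1)"
  have \<omega>: "\<omega> > 0" "d1 * \<omega>\<^sup>2 + c\<^sup>2 / (4 * d1) \<le> g"
    using g d1 by (auto simp: \<omega>_def)
  define R where "R = pi / (2 * \<omega>)"
  have "R > 0" using \<omega> by (simp add: R_def)
  have "\<exists>y\<in>{- 2 * R..0}. \<forall>x\<in>{- 2 * R..0}. u 1 y \<le> u 1 x"
    using \<open>R > 0\<close> by (intro continuous_attains_inf u_cont_space) auto
  then obtain y where y: "\<forall>x\<in>{- 2 * R..0}. u 1 y \<le> u 1 x" by blast
  define \<eta> where "\<eta> = min s (u 1 y) / exp (c * R / (2 * d1))"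
  have \<eta>: "\<eta> > 0" "\<eta> * exp (c * R / (2 * d1)) = min s (u 1 y)"
    using s pos[of y] by (auto simp: \<eta>_def)
  show ?thesis
  proof (rule that[OF \<open>R > 0\<close> \<eta>(1)])
    fix t x assume tx: "t \<ge> 1" "- R - c * (t - 1) \<le> x" "x \<le> - R"
    define c' where "c' = (if t = 1 then 0 else (- R - x) / (t - 1))"
    have c': "0 \<le> c'" "c' \<le> c" "c' * (t - 1) = - R - x"
      using tx c by (auto simp: c'_def divide_simps)
    have "\<eta> \<le> u t (- R - c' * (t - 1))"
    proof (rule moving_bump_lower_bound[OF \<omega> R_def s(2) \<eta>(1) _ _ _ c'(1,2) tx(1)])
      show "\<eta> * exp (c * R / (2 * d1)) \<le> u 1 x" if "- 2 * R \<le> x" "x \<le> 0" for x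
        unfolding \<eta>(2) using bspec[OF y, of x] that by simp
    qed (use \<eta>(2) in auto)
    then show "\<eta> \<le> u t x" using c'(3) by simp
  qed
qed

text \<open>
  The floor is used up to a front of speed \<open>c'\<close> strictly between \<open>c\<close> and the KPP speed. The distance
  from \<open>x \<ge> - c t\<close> to that front grows linearly, so the contribution of the moving end dies out;
  that of the interface is made small by staying to the left of \<open>- X\<close>.
\<close>

lemma KPP_convergence:
  assumes f1: "\<And>x. (f1 has_real_derivative deriv f1 x) (at x)" "KPP K f1" and K: "K > 0"
    and pos: "\<And>x. u 1 x > 0" and c: "0 \<le> c" "c < KPP_speed d1 f1" and \<delta>: "\<delta> > 0"
  obtains b where "\<forall>\<^sub>F t in at_top. \<forall>x\<in>{- c * t..b}. \<bar>u t x - K\<bar> \<le> \<delta>"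
proof -
  obtain c' where c': "c < c'" "c' < KPP_speed d1 f1" using c(2) dense by blast
  have "f1 0 = 0" using f1(2) by (simp add: KPP_def)
  have "0 \<le> c'" using c(1) c'(1) by linarith
  obtain R \<eta> where R: "R > 0" and \<eta>: "\<eta> > 0"
    and floor: "\<And>t x. t \<ge> 1 \<Longrightarrow> - R - c' * (t - 1) \<le> x \<Longrightarrow> x \<le> - R \<Longrightarrow> \<eta> \<le> u t x"
    using KPP_persistence[OF f1(1) \<open>f1 0 = 0\<close> pos \<open>0 \<le> c'\<close> c'(2)] by blast
  \<comment> \<open>This range contains the values of \<open>u\<close> above the floor and the capacity itself, so the same rate
    serves for the bounds from both sides.\<close>
  have "0 < min \<eta> K" "min \<eta> K \<le> max M K" using \<eta> K by auto
  from KPP_restoring[OF f1 this]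
  obtain \<kappa> where \<kappa>: "\<kappa> > 0"
    and below: "\<And>s. min \<eta> K \<le> s \<Longrightarrow> s \<le> K \<Longrightarrow> s \<le> max M K \<Longrightarrow> \<kappa> * (K - s) \<le> f1 s"
    and above: "\<And>s. min \<eta> K \<le> s \<Longrightarrow> K \<le> s \<Longrightarrow> s \<le> max M K \<Longrightarrow> f1 s \<le> - \<kappa> * (s - K)"
    by blast
  \<comment> \<open>Since \<open>\<nu> \<le> 1\<close>, the quadratic term in \<open>d1 * \<nu>\<^sup>2 + c' * \<nu>\<close> is dominated by a linear one.\<close>
  define \<nu> where "\<nu> = min 1 (\<kappa> / (d1 + c'))"
  have "d1 + c' > 0" using d1 c c' by linarith
  then have \<nu>: "\<nu> > 0" using \<kappa> by (simp add: \<nu>_def)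
  have \<nu>_le: "d1 * \<nu>\<^sup>2 + c' * \<nu> \<le> \<kappa>"
  proof -
    have "\<nu> \<le> 1" "\<nu> \<le> \<kappa> / (d1 + c')" by (auto simp: \<nu>_def)
    then have "(d1 + c') * \<nu> \<le> \<kappa>" using \<open>d1 + c' > 0\<close> by (simp add: field_simps)
    moreover have "\<nu> * \<nu> \<le> \<nu>" using mult_left_le[of \<nu> \<nu>] \<nu> \<open>\<nu> \<le> 1\<close> by simp
    then have "d1 * \<nu>\<^sup>2 \<le> d1 * \<nu>" using d1 by (simp add: power2_eq_square)
    ultimately show ?thesis by (simp add: distrib_right)
  qed
  define l where "l = sqrt (\<kappa> / d1)"
  have l: "l > 0" using \<kappa> d1 by (simp add: l_def)
  have "\<forall>\<^sub>F X in at_top. X \<ge> R \<and> M * exp (0 - l * X) \<le> \<delta> / 2 \<and> K * exp (\<nu> * R - \<nu> * X) \<le> \<delta> / 3"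
    using \<delta> l \<nu> by (intro eventually_conj eventually_ge_at_top exp_decay_eventually_small) auto
  then obtain X where X: "X \<ge> R" "M * exp (0 - l * X) \<le> \<delta> / 2" "K * exp (\<nu> * R - \<nu> * X) \<le> \<delta> / 3"
    unfolding eventually_at_top_linorder by blast
  have "\<forall>\<^sub>F t in at_top. t \<ge> 1 \<and> 0 \<le> (c' - c) * t + (R - c') \<and> M * exp (0 - \<kappa> * t) \<le> \<delta> / 2 \<and>
      K * exp (\<kappa> - \<kappa> * t) \<le> \<delta> / 3 \<and> K * exp (\<nu> * (c' - R) - \<nu> * (c' - c) * t) \<le> \<delta> / 3"
    using \<delta> \<kappa> \<nu> c'
    by (intro eventually_conj eventually_ge_at_top exp_decay_eventually_small linear_eventually_nonneg) auto
  then have "\<forall>\<^sub>F t in at_top. \<forall>x\<in>{- c * t..- X}. \<bar>u t x - K\<bar> \<le> \<delta>"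
  proof eventually_elim
    case (elim t)
    show ?case
    proof
      fix x assume x: "x \<in> {- c * t..- X}"
      have "x \<le> 0" "x \<le> - R" using x X R by auto
      have front: "0 \<le> (c' - c) * t + (R - c')" "(c' - c) * t + (R - c') \<le> x + R + c' * (t - 1)"
        using x elim by (auto simp: algebra_simps)
      have "u t x \<le> K + M * exp (- \<kappa> * t) + M * exp (l * x)"
        unfolding l_def
        by (rule KPP_capacity_upper_bound[OF \<kappa>]) (use K above elim \<open>x \<le> 0\<close> in auto)
      moreover have "M * exp (l * x) \<le> M * exp (0 - l * X)"
        using x l M mult_left_mono[of x "- X" l] by simp
      ultimately have "u t x \<le> K + \<delta>" using elim X by simp
      moreover have "K * (1 - exp (- \<kappa> * (t - 1)) - exp (\<nu> * (x + R)) - exp (- \<nu> * (x + R + c' * (t - 1)))) \<le> u t x"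
      proof (rule convergence_lower_bound[OF \<kappa> K _ less_imp_le[OF R] _ _ floor less_imp_le[OF \<nu>] \<nu>_le])
        show "\<kappa> * (K - s) \<le> f1 s" if "\<eta> \<le> s" "s \<le> K" for s
          using that by (intro below) auto
      qed (use c c' elim front \<open>x \<le> - R\<close> in auto)
      moreover have "K * exp (- \<kappa> * (t - 1)) \<le> \<delta> / 3"
        using elim by (simp add: algebra_simps)
      moreover have "K * exp (\<nu> * (x + R)) \<le> K * exp (\<nu> * R - \<nu> * X)"
        using x \<nu> K mult_left_mono[of x "- X" \<nu>] by (simp add: algebra_simps)
      moreover have "K * exp (- \<nu> * (x + R + c' * (t - 1))) \<le> K * exp (\<nu> * (c' - R) - \<nu> * (c' - c) * t)"
        using mult_left_mono[OF front(2), of \<nu>] \<nu> K by (simp add: algebra_simps)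
      ultimately have "K - \<delta> \<le> u t x" using elim X by (simp add: right_diff_distrib)
      with \<open>u t x \<le> K + \<delta>\<close> show "\<bar>u t x - K\<bar> \<le> \<delta>" by linarith
    qed
  qed
  then show ?thesis by (rule that)
qed

end

section \<open>Propagation of the solution of the two-patch problem\<close>

lemma solution_P_locale:
  assumes "solution_P d1 d2 \<sigma> f1 f2 u0 u" "d1 > 0" "d2 > 0" "\<sigma> > 0"
  obtains M ut1 ux1 uxx1 ut2 ux2 uxx2
  where "two_patch_solution d1 d2 \<sigma> f1 f2 u0 u M ut1 ux1 uxx1 ut2 ux2 uxx2"
proof -
  obtain ut1 ux1 uxx1 ut2 ux2 uxx2 where
    u: "continuous_on ({0..} \<times> UNIV) (\<lambda>(t, x). u t x)" "\<forall>x. u 0 x = u0 x"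
      "C12_with {..0} u ut1 ux1 uxx1" "C12_with {0..} u ut2 ux2 uxx2"
      "\<forall>t>0. \<forall>x<0. ut1 t x = d1 * uxx1 t x + f1 (u t x)"
      "\<forall>t>0. \<forall>x>0. ut2 t x = d2 * uxx2 t x + f2 (u t x)"
      "\<forall>t>0. ux1 t 0 = \<sigma> * ux2 t 0"
    and nonneg: "\<forall>t\<ge>0. \<forall>x. 0 \<le> u t x"
    and bdd: "bounded ((\<lambda>(t, x). u t x) ` ({0..} \<times> UNIV))"
    using assms(1) unfolding solution_P_def classical_solution_def by blast
  obtain M where M: "M > 0" "\<forall>v\<in>(\<lambda>(t, x). u t x) ` ({0..} \<times> UNIV). norm v \<le> M"
    using bdd unfolding bounded_pos by blast
  have "u t x \<le> M" if "t \<ge> 0" for t x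
  proof -
    have "u t x \<in> (\<lambda>(t, x). u t x) ` ({0..} \<times> UNIV)" using that by force
    then have "norm (u t x) \<le> M" using M(2) by blast
    then show ?thesis by simp
  qed
  then have "two_patch_solution d1 d2 \<sigma> f1 f2 u0 u M ut1 ux1 uxx1 ut2 ux2 uxx2"
    using assms(2-) u nonneg M(1) by unfold_locales auto
  then show ?thesis by (rule that)
qed

text \<open>
  The lower bounds start from time \<open>1\<close>, when the solution is positive everywhere; what remains is
  to translate all bounds into limits of suprema. A supremum in the extended reals is \<open>- \<infinity>\<close> over
  an empty interval, so the two limits equal to \<open>0\<close> need a point of the interval for the bound from
  below, whereas the upper limit does not.
\<close>

theorem theorem2p7:
  fixes d1 d2 \<sigma> K1 K2 \<theta> c1 :: real
    and f1 f2 u0 :: "real \<Rightarrow> real"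
    and u :: "real \<Rightarrow> real \<Rightarrow> real"
  assumes "d1 > 0" and "d2 > 0" and "\<sigma> > 0" and "K1 > 0" and "K2 > 0"
    and "f1 C1_differentiable_on UNIV" and "f2 C1_differentiable_on UNIV"
    and "KPP K1 f1"
    and "bistable \<theta> K2 f2"
    and "\<forall>x. 0 \<le> u0 x"
    and "continuous_on UNIV u0"
    and "compact (closure {x. u0 x \<noteq> 0})"
    and "\<exists>x. u0 x \<noteq> 0"
    and "solution_P d1 d2 \<sigma> f1 f2 u0 u"
    and "c1 = KPP_speed d1 f1"
  shows "(\<forall>xb. (INF x\<in>{..xb}. Liminf at_top (\<lambda>t. ereal (u t x))) > 0) \<and>
    c1 > 0 \<and>
    (\<forall>\<epsilon>>0. ((\<lambda>t. SUP x\<in>{..- (c1 + \<epsilon>) * t}. ereal (u t x)) \<longlongrightarrow> 0) at_top) \<and>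
    (\<forall>\<epsilon>\<in>{0<..<c1}. \<forall>\<delta>>0. \<exists>x1.
       Limsup at_top (\<lambda>t. SUP x\<in>{- (c1 - \<epsilon>) * t..x1}. ereal \<bar>u t x - K1\<bar>) < ereal \<delta>) \<and>
    (\<forall>c c'. 0 < c' \<and> c' \<le> c \<and> c < c1 \<longrightarrow>
       ((\<lambda>t. SUP x\<in>{- c * t..- c' * t}. ereal \<bar>u t x - K1\<bar>) \<longlongrightarrow> 0) at_top)"
proof -
  obtain M ut1 ux1 uxx1 ut2 ux2 uxx2 where
    "two_patch_solution d1 d2 \<sigma> f1 f2 u0 u M ut1 ux1 uxx1 ut2 ux2 uxx2"
    using solution_P_locale assms by metis
  then interpret two_patch_solution d1 d2 \<sigma> f1 f2 u0 u M ut1 ux1 uxx1 ut2 ux2 uxx2 .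

  note f1' = C1_has_deriv[OF assms(6)] and f2' = C1_has_deriv[OF assms(7)]
  note KPP = \<open>KPP K1 f1\<close> and K1 = \<open>K1 > 0\<close>
  have zero: "f1 0 = 0" "f2 0 = 0" using KPP \<open>bistable \<theta> K2 f2\<close> by (auto simp: KPP_def bistable_def)
  define r where "r = deriv f1 0"
  have r: "r > 0" using KPP_rate_pos[OF KPP K1] by (simp add: r_def)
  have c1: "c1 = 2 * sqrt (d1 * r)" using assms(15) by (simp add: KPP_speed_def r_def)
  have "c1 > 0" using r d1 by (simp add: c1)

  obtain m1 where m1: "m1 > 0" "\<And>s. 0 \<le> s \<Longrightarrow> s \<le> M \<Longrightarrow> - m1 * s \<le> f1 s"
    using linear_lower_bound[OF f1' zero(1) M] by blast
  obtain m2 where m2: "m2 > 0" "\<And>s. 0 \<le> s \<Longrightarrow> s \<le> M \<Longrightarrow> - m2 * s \<le> f2 s"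
    using linear_lower_bound[OF f2' zero(2) M] by blast
  \<comment> \<open>By continuity the point where the datum is positive can be moved off the interface.\<close>
  obtain x0 where x0: "u0 x0 > 0" "x0 \<noteq> 0"
  proof -
    obtain y where "u0 y > 0" using assms(10,13) by (metis less_eq_real_def)
    have "isCont u0 y" using assms(11) by (simp add: continuous_on_eq_continuous_at)
    then have "\<forall>\<^sub>F z in at y. u0 z > 0"
      using \<open>u0 y > 0\<close> by (auto simp: isCont_def intro: order_tendstoD(1))
    moreover have "\<forall>\<^sub>F z in at y. z \<noteq> 0"
      by (cases "y = 0") (auto simp: eventually_at_filter intro!: eventually_mono[OF t1_space_nhds])
    ultimately have "\<forall>\<^sub>F z in at y. u0 z > 0 \<and> z \<noteq> 0" by (rule eventually_conj)
    then have "\<exists>z. u0 z > 0 \<and> z \<noteq> 0" by (rule eventually_happens'[rotated]) simp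
    then show ?thesis using that by blast
  qed
  have pos: "u t x > 0" if "t > 0" for t x
  proof (rule strictly_positive[OF _ _ _ x0 that])
    show "max m1 m2 > 0" using m1 by simp
    fix s assume s: "0 \<le> s" "s \<le> M"
    have "- max m1 m2 * s \<le> - m1 * s" "- max m1 m2 * s \<le> - m2 * s"
      using s by (auto intro!: mult_right_mono)
    then show "- max m1 m2 * s \<le> f1 s" "- max m1 m2 * s \<le> f2 s"
      using m1(2)[OF s] m2(2)[OF s] by linarith+
  qed
  then have pos1: "u 1 x > 0" for x by simp

  have persistence: "(INF x\<in>{..xb}. Liminf at_top (\<lambda>t. ereal (u t x))) > 0" for xb
  proof -
    define c where "c = c1 / 2"
    have c: "0 < c" "c < KPP_speed d1 f1" using \<open>c1 > 0\<close> assms(15) by (auto simp: c_def)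
    obtain R \<eta> where R: "R > 0" and \<eta>: "\<eta> > 0"
      and floor: "\<And>t x. t \<ge> 1 \<Longrightarrow> - R - c * (t - 1) \<le> x \<Longrightarrow> x \<le> - R \<Longrightarrow> \<eta> \<le> u t x"
      using KPP_persistence[OF f1' zero(1) pos1 less_imp_le[OF c(1)] c(2)] by blast
    have edge: "\<eta> \<le> u t (- R)" if "t \<ge> 1" for t
      using floor[OF that, of "- R"] that c by simp
    have f1_nonneg: "0 \<le> f1 s" if "0 \<le> s" "s \<le> K1" for s
      using KPP that by (cases "s = 0"; cases "s = K1") (auto simp: KPP_def less_imp_le)
    obtain \<delta> where \<delta>: "\<delta> > 0" "\<And>t x. t \<ge> 1 \<Longrightarrow> - R \<le> x \<Longrightarrow> x \<le> xb \<Longrightarrow> \<delta> \<le> u t x"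
      using interface_crossing_lower_bound[OF K1 f1_nonneg m2 R \<eta> zero_le_one edge pos1] by blast
    have "ereal (min \<eta> \<delta>) \<le> Liminf at_top (\<lambda>t. ereal (u t x))" if "x \<le> xb" for x
    proof (rule Liminf_bounded)
      have "\<forall>\<^sub>F t in at_top. 0 \<le> c * t + (x + R - c)"
        using c by (intro linear_eventually_nonneg)
      then show "\<forall>\<^sub>F t in at_top. ereal (min \<eta> \<delta>) \<le> ereal (u t x)"
        using eventually_ge_at_top[of 1]
      proof eventually_elim
        case (elim t)
        show ?case
        proof (cases "x \<le> - R")
          case True
          then have "\<eta> \<le> u t x" using elim by (intro floor) (auto simp: algebra_simps)
          then show ?thesis by (simp add: min_le_iff_disj)
        next
          case False
          then have "\<delta> \<le> u t x" using elim that by (intro \<delta>(2)) auto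
          then show ?thesis by (simp add: min_le_iff_disj)
        qed
      qed
    qed
    then have "ereal (min \<eta> \<delta>) \<le> (INF x\<in>{..xb}. Liminf at_top (\<lambda>t. ereal (u t x)))"
      by (intro INF_greatest) simp
    moreover have "0 < ereal (min \<eta> \<delta>)" using \<eta> \<delta>(1) by simp
    ultimately show ?thesis by (rule less_le_trans[rotated])
  qed

  have ahead: "((\<lambda>t. SUP x\<in>{..- (c1 + \<epsilon>) * t}. ereal (u t x)) \<longlongrightarrow> 0) at_top" if "\<epsilon> > 0" for \<epsilon>
  proof -
    have "bounded {x. u0 x \<noteq> 0}"
      using compact_imp_bounded[OF assms(12)] closure_subset by (rule bounded_subset)
    then obtain L where L: "L > 0" "\<forall>x\<in>{x. u0 x \<noteq> 0}. norm x \<le> L"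
      unfolding bounded_pos by blast
    have f1_le: "f1 s \<le> r * s" if "0 \<le> s" for s
    proof -
      consider "s = 0" | "0 < s" "s < K1" | "s = K1" | "s > K1" using \<open>0 \<le> s\<close> by linarith
      then show ?thesis
      proof cases
        case 4
        then have "f1 s < 0" "r * s \<ge> 0" using KPP r that by (auto simp: KPP_def)
        then show ?thesis by linarith
      qed (use KPP r K1 zero in \<open>auto simp: KPP_def r_def\<close>)
    qed
    define l where "l = sqrt (r / d1)"
    have l: "l > 0" using r d1 by (simp add: l_def)
    have upper: "u t x \<le> M * exp (l * L - l * \<epsilon> * t)" if "t \<ge> 0" "x \<le> - (c1 + \<epsilon>) * t" for t x
    proof -
      have "0 \<le> (c1 + \<epsilon>) * t" using that \<open>c1 > 0\<close> \<open>\<epsilon> > 0\<close> by simp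
      then have "x \<le> 0" using that unfolding mult_minus_left by linarith
      have "u t x \<le> M * exp (l * (x + L + c1 * t))"
        unfolding l_def c1
        by (rule KPP_speed_upper_bound[OF r f1_le _ _ that(1) \<open>x \<le> 0\<close>]) (use L in \<open>force+\<close>)
      also have "l * (x + L + c1 * t) \<le> l * (L - \<epsilon> * t)"
        using that l by (intro mult_left_mono) (auto simp: algebra_simps)
      then have "M * exp (l * (x + L + c1 * t)) \<le> M * exp (l * L - l * \<epsilon> * t)"
        using M by (simp add: algebra_simps)
      finally show ?thesis .
    qed
    show ?thesis
    proof (rule tendsto_sandwich)
      show "((\<lambda>t. 0) \<longlongrightarrow> 0) at_top" by simp
      have "((\<lambda>t. M * exp (l * L - l * \<epsilon> * t)) \<longlongrightarrow> 0) at_top"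
        using l \<open>\<epsilon> > 0\<close> by (intro exp_decay) simp
      then show "((\<lambda>t. ereal (M * exp (l * L - l * \<epsilon> * t))) \<longlongrightarrow> 0) at_top"
        unfolding zero_ereal_def by (rule tendsto_ereal)
      show "\<forall>\<^sub>F t in at_top. 0 \<le> (SUP x\<in>{..- (c1 + \<epsilon>) * t}. ereal (u t x))"
        using eventually_ge_at_top[of 0]
      proof eventually_elim
        case (elim t)
        then have "0 \<le> ereal (u t (- (c1 + \<epsilon>) * t))" using u_nonneg by simp
        then show ?case by (rule SUP_upper2[rotated]) simp
      qed
      show "\<forall>\<^sub>F t in at_top. (SUP x\<in>{..- (c1 + \<epsilon>) * t}. ereal (u t x)) \<le> ereal (M * exp (l * L - l * \<epsilon> * t))"
        using eventually_ge_at_top[of 0]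
        by eventually_elim (auto intro!: SUP_least upper)
    qed
  qed

  have behind: "\<exists>x1. \<forall>\<^sub>F t in at_top. \<forall>x\<in>{- c * t..x1}. \<bar>u t x - K1\<bar> \<le> \<delta>"
    if "0 < c" "c < c1" "\<delta> > 0" for c \<delta>
    using KPP_convergence[OF f1' KPP K1 pos1 less_imp_le[OF that(1)] _ that(3)] that(2) assms(15) by blast

  have plateau: "\<exists>x1. Limsup at_top (\<lambda>t. SUP x\<in>{- (c1 - \<epsilon>) * t..x1}. ereal \<bar>u t x - K1\<bar>) < ereal \<delta>"
    if \<epsilon>: "\<epsilon> \<in> {0<..<c1}" and \<delta>: "\<delta> > 0" for \<epsilon> \<delta>
  proof -
    obtain x1 where x1: "\<forall>\<^sub>F t in at_top. \<forall>x\<in>{- (c1 - \<epsilon>) * t..x1}. \<bar>u t x - K1\<bar> \<le> \<delta> / 2"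
      using behind[of "c1 - \<epsilon>" "\<delta> / 2"] \<epsilon> \<delta> by auto
    have "Limsup at_top (\<lambda>t. SUP x\<in>{- (c1 - \<epsilon>) * t..x1}. ereal \<bar>u t x - K1\<bar>) \<le> ereal (\<delta> / 2)"
      by (rule Limsup_bounded, use x1 in eventually_elim) (auto intro!: SUP_least)
    also have "\<dots> < ereal \<delta>" using \<delta> by simp
    finally show ?thesis by blast
  qed

  have uniform: "((\<lambda>t. SUP x\<in>{- c * t..- c' * t}. ereal \<bar>u t x - K1\<bar>) \<longlongrightarrow> 0) at_top"
    if c: "0 < c'" "c' \<le> c" "c < c1" for c c'
  proof (rule order_tendstoI)
    fix a :: ereal assume "a < 0"
    show "\<forall>\<^sub>F t in at_top. a < (SUP x\<in>{- c * t..- c' * t}. ereal \<bar>u t x - K1\<bar>)"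
      using eventually_ge_at_top[of 0]
    proof eventually_elim
      case (elim t)
      have "- c * t \<in> {- c * t..- c' * t}" using c elim by (simp add: mult_right_mono)
      then have "ereal \<bar>u t (- c * t) - K1\<bar> \<le> (SUP x\<in>{- c * t..- c' * t}. ereal \<bar>u t x - K1\<bar>)"
        by (rule SUP_upper)
      moreover have "0 \<le> ereal \<bar>u t (- c * t) - K1\<bar>" by simp
      ultimately show ?case using \<open>a < 0\<close> by (meson less_le_trans order_trans)
    qed
  next
    fix a :: ereal assume "0 < a"
    then obtain \<delta> where \<delta>: "0 < ereal \<delta>" "ereal \<delta> < a" using ereal_dense2 by blast
    have "0 < c" using c by linarith
    obtain x1 where x1: "\<forall>\<^sub>F t in at_top. \<forall>x\<in>{- c * t..x1}. \<bar>u t x - K1\<bar> \<le> \<delta>"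
      using behind[OF \<open>0 < c\<close> c(3), of \<delta>] \<delta>(1) by auto
    have "\<forall>\<^sub>F t in at_top. 0 \<le> c' * t + x1" using c by (intro linear_eventually_nonneg)
    with x1 show "\<forall>\<^sub>F t in at_top. (SUP x\<in>{- c * t..- c' * t}. ereal \<bar>u t x - K1\<bar>) < a"
    proof eventually_elim
      case (elim t)
      have "(SUP x\<in>{- c * t..- c' * t}. ereal \<bar>u t x - K1\<bar>) \<le> ereal \<delta>"
        by (rule SUP_least) (use elim in auto)
      then show ?case using \<delta>(2) by (rule le_less_trans)
    qed
  qed

  show ?thesis using persistence \<open>c1 > 0\<close> ahead plateau uniform by blast
qed

end
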